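(* Let $\{G^N\}_N$ be an $f$-sequence with stepwise $f$ that is in the $\mathbf p$-subcritical regime, operated under the $\mathbf p$-based JIQ policy. Given the all-empty initial state, for any $T>0$, the probability that during the time interval $[0,T]$ some arriving task is assigned to a busy server converges to $0$ as $N\to\infty$.
   Context: Notation: $[n]=\{1,\dots,n\}$. Model. $G^N=(\mathcal W^N,\mathcal V^N,\boldsymbol\lambda^N,\mathcal U^N)$ is a load balancing system with dispatchers $\mathcal W^N=\{1,\dots,W(N)\}$ (each dispatcher handles exactly one type of task, so dispatcher = task type) and servers $\mathcal V^N=\{1,\dots,N\}$. Each server has its own infinite-buffer queue served First-Come-First-Served. Tasks arrive at dispatcher $i$ as a Poisson process of rate $\lambda_i^N$, independently of everything else, and must be assigned immediately and irrevocably to a server. The service time of a type-$i$ task at server $j$ is exponential with mean $1/\mu^N_{i,j}$ if $\mu^N_{i,j}>0$ (all service times independent); if $\mu^N_{i,j}=0$ server $j$ cannot process type-$i$ tasks. $\mathcal U^N=(\mu^N_{i,j})$. A server is busy if its queue (including the task in service) is non-empty and idle otherwise. $f$-sequence. There are fixed maps $\phi_1,\phi_2:\mathbb N\to[0,1)$ (for dispatchers and servers), and $f:[0,1)^2\to\mathbb R_+$; the sets $\mathcal W^N,\mathcal V^N$ are increasing in $N$, and $\mu^N_{i,j}=f(\phi_1(i),\phi_2(j))$ for all $(i,j)\in\mathcal W^N\times\mathcal V^N$. Stepwise $f$. There are partitions $0=w_0<\dots<w_H=1$ and $0=v_0<\dots<v_M=1$ and constants $\mu_{h,m}\ge0$ with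 $f(x,y)=\mu_{h,m}$ for $(x,y)\in[w_{h-1},w_h)\times[v_{m-1},v_m)$. Put $\mathcal W^N_h=\{i\in\mathcal W^N:\phi_1(i)\in[w_{h-1},w_h)\}$ and $\mathcal V^N_m=\{j\in\mathcal V^N:\phi_2(j)\in[v_{m-1},v_m)\}$. $\mathbf p$-subcritical regime. (i) For each $h$, $\lim_N \frac1N\sum_{i\in\mathcal W^N_h}\lambda^N_i=\lambda_h>0$; (ii) for each $m$, $\lim_N|\mathcal V^N_m|/N=v_m-v_{m-1}$; (iii) $\mathbf p=(p_{h,m})\in[0,1]^{H\times M}$ has unit row sums and $\sum_{h\in[H]}\frac{\lambda_hp_{h,m}}{\mu_{h,m}(v_m-v_{m-1})}<1$ for all $m\in[M]$. Convention: a quotient with numerator $0$ is $0$, and one with positive numerator and zero denominator is $+\infty$ (so $p_{h,m}>0$ forces $\mu_{h,m}>0$). $\mathbf p$-based JIQ policy. When a task arrives at a dispatcher $i\in\mathcal W^N_h$, the dispatcher first selects a target type $m^*\in[M]$ at random with distribution $(p_{h,m})_{m\in[M]}$ (independently of everything else); the task is then sent to a uniformly random idle server in $\mathcal V^N_{m^*}$ if there is one, and otherwise to a uniformly random server in $\mathcal V^N_{m^*}$. *)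

theory Defs
  imports "HOL-Probability.Probability"
begin

section \<open>Sequences of load balancing systems with stepwise service rates\<close>

text \<open>
  Throughout, \<open>N\<close> is the number of servers, the servers of the \<open>N\<close>-th system are \<open>{1..N}\<close> and its
  dispatchers are \<open>{1..W N}\<close>; \<open>lam N i\<close> is the arrival rate at dispatcher \<open>i\<close> and \<open>\<mu> N i j\<close> the
  service rate of tasks of dispatcher \<open>i\<close> at server \<open>j\<close>.
\<close>

definition f_sequence ::
  "(real \<Rightarrow> real \<Rightarrow> real) \<Rightarrow> (nat \<Rightarrow> real) \<Rightarrow> (nat \<Rightarrow> real) \<Rightarrow> (nat \<Rightarrow> nat) \<Rightarrow> (nat \<Rightarrow> nat \<Rightarrow> nat \<Rightarrow> real) \<Rightarrow> bool"
where
  "f_sequence f \<phi>\<^sub>1 \<phi>\<^sub>2 W \<mu> \<longleftrightarrow>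
     (\<forall>x\<in>{0..<1}. \<forall>y\<in>{0..<1}. 0 \<le> f x y) \<and>
     (\<forall>i\<ge>1. \<phi>\<^sub>1 i \<in> {0..<1}) \<and> (\<forall>j\<ge>1. \<phi>\<^sub>2 j \<in> {0..<1}) \<and>
     mono_on {1..} W \<and>
     (\<forall>N\<ge>1. \<forall>i\<in>{1..W N}. \<forall>j\<in>{1..N}. \<mu> N i j = f (\<phi>\<^sub>1 i) (\<phi>\<^sub>2 j))"

definition unit_partition :: "nat \<Rightarrow> (nat \<Rightarrow> real) \<Rightarrow> bool" where
  "unit_partition n w \<longleftrightarrow> w 0 = 0 \<and> w n = 1 \<and> strict_mono_on {0..n} w"

definition cell :: "(nat \<Rightarrow> real) \<Rightarrow> nat \<Rightarrow> real set" where
  "cell w h = {w (h - 1)..<w h}"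

definition stepwise ::
  "nat \<Rightarrow> nat \<Rightarrow> (nat \<Rightarrow> real) \<Rightarrow> (nat \<Rightarrow> real) \<Rightarrow> (nat \<Rightarrow> nat \<Rightarrow> real) \<Rightarrow> (real \<Rightarrow> real \<Rightarrow> real) \<Rightarrow> bool"
where
  "stepwise H M w v r f \<longleftrightarrow>
     unit_partition H w \<and> unit_partition M v \<and>
     (\<forall>h\<in>{1..H}. \<forall>m\<in>{1..M}. 0 \<le> r h m \<and> (\<forall>x\<in>cell w h. \<forall>y\<in>cell v m. f x y = r h m))"

text \<open>The indices \<open>1, \<dots>, n\<close> of type \<open>h\<close>; used both for dispatchers and for servers.\<close>

definition of_type :: "(nat \<Rightarrow> real) \<Rightarrow> (nat \<Rightarrow> real) \<Rightarrow> nat \<Rightarrow> nat \<Rightarrow> nat set" where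
  "of_type \<phi> w n h = {i\<in>{1..n}. \<phi> i \<in> cell w h}"

text \<open>
  The load condition is stated in \<^typ>\<open>ereal\<close>, where \<open>0 / 0 = 0\<close> and \<open>x / 0 = \<infinity>\<close> for \<open>x > 0\<close>.
\<close>

definition subcritical ::
  "nat \<Rightarrow> nat \<Rightarrow> (nat \<Rightarrow> real) \<Rightarrow> (nat \<Rightarrow> real) \<Rightarrow> (nat \<Rightarrow> nat \<Rightarrow> real) \<Rightarrow> (nat \<Rightarrow> real) \<Rightarrow> (nat \<Rightarrow> real) \<Rightarrow>
   (nat \<Rightarrow> nat) \<Rightarrow> (nat \<Rightarrow> nat \<Rightarrow> real) \<Rightarrow> (nat \<Rightarrow> real) \<Rightarrow> (nat \<Rightarrow> nat \<Rightarrow> real) \<Rightarrow> bool"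
where
  "subcritical H M w v r \<phi>\<^sub>1 \<phi>\<^sub>2 W lam \<Lambda> p \<longleftrightarrow>
     (\<forall>h\<in>{1..H}. 0 < \<Lambda> h \<and>
        (\<lambda>N. (\<Sum>i\<in>of_type \<phi>\<^sub>1 w (W N) h. lam N i) / real N) \<longlonglongrightarrow> \<Lambda> h) \<and>
     (\<forall>m\<in>{1..M}. (\<lambda>N. real (card (of_type \<phi>\<^sub>2 v N m)) / real N) \<longlonglongrightarrow> v m - v (m - 1)) \<and>
     (\<forall>h\<in>{1..H}. \<forall>m\<in>{1..M}. p h m \<in> {0..1}) \<and>
     (\<forall>h\<in>{1..H}. (\<Sum>m=1..M. p h m) = 1) \<and>
     (\<forall>m\<in>{1..M}. (\<Sum>h=1..H. ereal (\<Lambda> h * p h m) / ereal (r h m * (v m - v (m - 1)))) < 1)"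


section \<open>Dynamics for fixed realisations of the random inputs\<close>

text \<open>
  A task is a pair \<open>(i, k)\<close>: the \<open>k\<close>-th task, counted from \<open>0\<close>, arriving at dispatcher \<open>i\<close>; \<open>x i k\<close> is
  the time between its arrival and the preceding one (or time \<open>0\<close>). Dispatchers of rate \<open>0\<close> receive
  no tasks. Simultaneous arrivals and infinitely many arrivals before \<open>T\<close> have probability \<open>0\<close>, so
  that almost surely this list contains all arrivals in \<open>[0, T]\<close> in chronological order.
\<close>

type_synonym task = "nat \<times> nat"

definition arrival :: "(nat \<Rightarrow> nat \<Rightarrow> real) \<Rightarrow> task \<Rightarrow> real" where
  "arrival x = (\<lambda>(i, k). \<Sum>l\<le>k. x i l)"

definition arriving_tasks :: "nat \<Rightarrow> (nat \<Rightarrow> real) \<Rightarrow> (nat \<Rightarrow> nat \<Rightarrow> real) \<Rightarrow> real \<Rightarrow> task list" where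
  "arriving_tasks W lam x T =
     sort_key (arrival x)
       [(i, k). i \<leftarrow> [1..<Suc W], 0 < lam i, k \<leftarrow> sorted_list_of_set {k. arrival x (i, k) \<le> T}]"

text \<open>
  A history records the server and the departure time of every task assigned so far. Departure
  times are known upon assignment, since the queues are served First-Come-First-Served; a task that
  its server cannot process has departure time \<open>\<infinity>\<close>.
\<close>

type_synonym history = "(nat \<times> ereal) list"

definition queue :: "history \<Rightarrow> real \<Rightarrow> nat \<Rightarrow> history" where
  "queue hist t j = filter (\<lambda>(j', d). j' = j \<and> ereal t < d) hist"

definition busy :: "history \<Rightarrow> real \<Rightarrow> nat \<Rightarrow> bool" where
  "busy hist t j \<longleftrightarrow> queue hist t j \<noteq> []"

text \<open>
  Service of a task that arrives at time \<open>t\<close> starts once all earlier tasks at its server have left.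
\<close>

definition departure :: "history \<Rightarrow> real \<Rightarrow> nat \<Rightarrow> ereal \<Rightarrow> ereal" where
  "departure hist t j s = Max (insert (ereal t) (snd ` set (queue hist t j))) + s"

text \<open>
  An assignment policy maps a task and the set of servers that are busy upon its arrival to a server.
  \<open>a\<close> gives the arrival times, \<open>s\<close> the service time of each task at each server. The function tells
  whether one of the listed tasks, processed in this order after \<open>hist\<close>, is assigned to a busy server.
\<close>

fun assigned_to_busy ::
  "(task \<Rightarrow> nat set \<Rightarrow> nat) \<Rightarrow> (task \<Rightarrow> real) \<Rightarrow> (task \<Rightarrow> nat \<Rightarrow> ereal) \<Rightarrow> history \<Rightarrow> task list \<Rightarrow> bool"
where
  "assigned_to_busy policy a s hist [] = False"
| "assigned_to_busy policy a s hist (\<tau> # \<tau>s) =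
     (let j = policy \<tau> {j. busy hist (a \<tau>) j}
      in busy hist (a \<tau>) j \<or>
         assigned_to_busy policy a s (hist @ [(j, departure hist (a \<tau>) j (s \<tau> j))]) \<tau>s)"

text \<open>
  If \<open>u\<close> is uniform on \<open>[0, 1]\<close>, then \<open>pick A u\<close> is uniform on the finite nonempty set \<open>A\<close>. The value
  of \<open>pick {} u\<close> is unspecified; it is used only if a target pool is empty, which under
  \<open>subcritical\<close> does not happen for large \<open>N\<close>.
\<close>

definition pick :: "nat set \<Rightarrow> real \<Rightarrow> nat" where
  "pick A u = sorted_list_of_set A ! nat \<lfloor>u * real (card A)\<rfloor>"

text \<open>\<open>z i k\<close> is the target type of the task \<open>(i, k)\<close>, \<open>pool m\<close> the set of servers of type \<open>m\<close>.\<close>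

definition jiq_policy ::
  "(nat \<Rightarrow> nat set) \<Rightarrow> (nat \<Rightarrow> nat \<Rightarrow> nat) \<Rightarrow> (nat \<Rightarrow> nat \<Rightarrow> real) \<Rightarrow> task \<Rightarrow> nat set \<Rightarrow> nat"
where
  "jiq_policy pool z u = (\<lambda>(i, k) B.
     let V = pool (z i k) in pick (if V - B \<noteq> {} then V - B else V) (u i k))"

text \<open>
  The case distinction on \<open>j \<le> N\<close> only serves to have no unspecified service times; tasks are assigned
  to servers in \<open>{1..N}\<close> whenever their target pool is nonempty.
\<close>

definition service_time ::
  "nat \<Rightarrow> (nat \<Rightarrow> nat \<Rightarrow> real) \<Rightarrow> (nat \<Rightarrow> nat \<Rightarrow> nat \<Rightarrow> real) \<Rightarrow> task \<Rightarrow> nat \<Rightarrow> ereal"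
where
  "service_time N rate s = (\<lambda>(i, k) j.
     if j \<in> {1..N} \<and> 0 < rate i j then ereal (s i k j) else \<infinity>)"


section \<open>The random inputs\<close>

datatype input =
    Interarrival nat nat
  | Target nat nat
  | Selection nat nat
  | Service nat nat nat

text \<open>
  One system under JIQ: \<open>cls h\<close> are the dispatchers of type \<open>h\<close>. The arrivals at dispatcher \<open>i\<close> form a
  Poisson process, i.e. have independent exponential interarrival times. The service time
  \<open>S i k j\<close> is the one that the task \<open>(i, k)\<close> has if it is assigned to server \<open>j\<close>.
\<close>

locale jiq_inputs = prob_space P
  for P :: "'a measure" +
  fixes N W H M :: nat
    and cls :: "nat \<Rightarrow> nat set"
    and p :: "nat \<Rightarrow> nat \<Rightarrow> real"
    and lam :: "nat \<Rightarrow> real"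
    and rate :: "nat \<Rightarrow> nat \<Rightarrow> real"
    and X :: "nat \<Rightarrow> nat \<Rightarrow> 'a \<Rightarrow> real"
    and Z :: "nat \<Rightarrow> nat \<Rightarrow> 'a \<Rightarrow> nat"
    and U :: "nat \<Rightarrow> nat \<Rightarrow> 'a \<Rightarrow> real"
    and S :: "nat \<Rightarrow> nat \<Rightarrow> nat \<Rightarrow> 'a \<Rightarrow> real"
  assumes lam_nonneg: "\<And>i. i \<in> {1..W} \<Longrightarrow> 0 \<le> lam i"
    and interarrival:
      "\<And>i k. \<lbrakk>i \<in> {1..W}; 0 < lam i\<rbrakk> \<Longrightarrow> distributed P lborel (X i k) (exponential_density (lam i))"
    and target:
      "\<And>h i k m. \<lbrakk>h \<in> {1..H}; i \<in> cls h; i \<in> {1..W}; 0 < lam i; m \<in> {1..M}\<rbrakk>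
         \<Longrightarrow> \<P>(\<omega> in P. Z i k \<omega> = m) = p h m"
    and selection:
      "\<And>i k. \<lbrakk>i \<in> {1..W}; 0 < lam i\<rbrakk> \<Longrightarrow> distr P borel (U i k) = uniform_measure lborel {0..1}"
    and service:
      "\<And>i k j. \<lbrakk>i \<in> {1..W}; 0 < lam i; j \<in> {1..N}; 0 < rate i j\<rbrakk>
         \<Longrightarrow> distributed P lborel (S i k j) (exponential_density (rate i j))"
    and independent:
      "indep_vars (\<lambda>_. borel)
         (\<lambda>c. case c of
            Interarrival i k \<Rightarrow> X i k
          | Target i k \<Rightarrow> (\<lambda>\<omega>. real (Z i k \<omega>))
          | Selection i k \<Rightarrow> U i k
          | Service i k j \<Rightarrow> S i k j)
         (\<Union>i\<in>{i\<in>{1..W}. 0 < lam i}. \<Union>k.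
            {Interarrival i k, Target i k, Selection i k} \<union>
            Service i k ` {j\<in>{1..N}. 0 < rate i j})"

text \<open>
  Some task arriving during \<open>[0, T]\<close> is assigned to a busy server, starting from empty queues.
\<close>

definition jiq_busy_event ::
  "'a measure \<Rightarrow> nat \<Rightarrow> nat \<Rightarrow> (nat \<Rightarrow> nat set) \<Rightarrow> (nat \<Rightarrow> real) \<Rightarrow> (nat \<Rightarrow> nat \<Rightarrow> real) \<Rightarrow>
   (nat \<Rightarrow> nat \<Rightarrow> 'a \<Rightarrow> real) \<Rightarrow> (nat \<Rightarrow> nat \<Rightarrow> 'a \<Rightarrow> nat) \<Rightarrow> (nat \<Rightarrow> nat \<Rightarrow> 'a \<Rightarrow> real) \<Rightarrow>
   (nat \<Rightarrow> nat \<Rightarrow> nat \<Rightarrow> 'a \<Rightarrow> real) \<Rightarrow> real \<Rightarrow> 'a set"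
where
  "jiq_busy_event P N W pool lam rate X Z U S T =
     {\<omega> \<in> space P.
        let x = (\<lambda>i k. X i k \<omega>) in
        assigned_to_busy
          (jiq_policy pool (\<lambda>i k. Z i k \<omega>) (\<lambda>i k. U i k \<omega>))
          (arrival x)
          (service_time N rate (\<lambda>i k j. S i k j \<omega>))
          []
          (arriving_tasks W lam x T)}"

end

theory Submission
  imports Defs
begin

text \<open>
  As long as only idle servers have been chosen, no task waits, so the number of busy servers of type
  \<open>m\<close> is the number of tasks of target type \<open>m\<close> that have arrived and not yet completed their
  service. All servers of type \<open>m\<close> serve a given dispatcher at the same rate, so service times
  are exponential and independent of the arrivals and targets, however the servers are chosen. The
  number of tasks that are present at some time of a window \<open>[t, t + d]\<close> hence has the first two
  moments of a Poisson variable, with mean at most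
  \<open>N (\<Sum>h. \<Lambda>\<^sub>h p\<^sub>h\<^sub>m (1 / \<mu>\<^sub>h\<^sub>m + d) + o(1))\<close>. For small fixed \<open>d\<close> this is smaller than
  the number of servers of type \<open>m\<close> by an amount of order \<open>N\<close>, so Chebyshev's inequality and
  a union bound over the finitely many windows covering \<open>[0, T]\<close> show that no pool is ever
  exhausted, with probability tending to \<open>1\<close>.
\<close>

section \<open>Measurability of the dynamics\<close>

lemma measurable_count_space_countableI:
  fixes f :: "'a \<Rightarrow> 'b::countable"
  assumes "\<And>y. {x \<in> space \<M>. f x = y} \<in> sets \<M>"
  shows "f \<in> measurable \<M> (count_space UNIV)"
  using assms by (auto simp: measurable_count_space_eq2_countable vimage_def Int_def conj_commute)

lemma measurable_sorted_list_of_set: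
  fixes K :: "'a \<Rightarrow> nat set"
  assumes [measurable]: "\<And>k. Measurable.pred \<M> (\<lambda>x. k \<in> K x)"
  shows "(\<lambda>x. sorted_list_of_set (K x)) \<in> measurable \<M> (count_space UNIV)"
proof (rule measurable_count_space_countableI)
  fix l :: "nat list"
  have "sorted_list_of_set (K x) = l \<longleftrightarrow>
     (sorted l \<and> distinct l \<and> (\<forall>k. k \<in> K x \<longleftrightarrow> k \<in> set l)) \<or> (l = [] \<and> (\<forall>n. \<exists>k. n \<le> k \<and> k \<in> K x))" for x
  proof (cases "finite (K x)")
    case True
    then have "\<not> (\<forall>n. \<exists>k. n \<le> k \<and> k \<in> K x)"
      by (meson finite_nat_set_iff_bounded not_less)
    moreover have "sorted_list_of_set (K x) = l \<longleftrightarrow> (sorted l \<and> distinct l \<and> K x = set l)"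
      using True sorted_list_of_set_unique[OF True, of l]
      by (auto simp: strict_sorted_iff distinct_card
          intro!: sorted_list_of_set.idem_if_sorted_distinct)
    ultimately show ?thesis by auto
  next
    case False
    then have "(\<forall>n. \<exists>k. n \<le> k \<and> k \<in> K x)" and "\<not> (\<forall>k. k \<in> K x \<longleftrightarrow> k \<in> set l)"
      by (auto simp: finite_nat_set_iff_bounded not_less)
         (metis List.finite_set finite_nat_set_iff_bounded not_less)
    then show ?thesis using False by auto
  qed
  then show "{x \<in> space \<M>. sorted_list_of_set (K x) = l} \<in> sets \<M>"
    by simp
qed

lemma measurable_insort_key:
  fixes key :: "'a \<Rightarrow> 'b::countable \<Rightarrow> real"
  assumes "\<And>y. y \<in> set (y0 # ys) \<Longrightarrow> (\<lambda>x. key x y) \<in> borel_measurable \<M>"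
  shows "(\<lambda>x. insort_key (key x) y0 ys) \<in> measurable \<M> (count_space UNIV)"
  using assms
proof (induction ys)
  case (Cons y ys)
  have [measurable]: "(\<lambda>x. key x y0) \<in> borel_measurable \<M>" "(\<lambda>x. key x y) \<in> borel_measurable \<M>"
    using Cons.prems by auto
  have [measurable]: "(\<lambda>x. insort_key (key x) y0 ys) \<in> measurable \<M> (count_space UNIV)"
    using Cons by auto
  show ?case by simp
qed simp

lemma measurable_sort_key:
  fixes key :: "'a \<Rightarrow> 'b::countable \<Rightarrow> real"
  assumes "\<And>y. y \<in> D \<Longrightarrow> (\<lambda>x. key x y) \<in> borel_measurable \<M>" and "ys \<in> lists D"
  shows "(\<lambda>x. sort_key (key x) ys) \<in> measurable \<M> (count_space (lists D))"
  using assms(2)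
proof (induction ys)
  case Nil
  show ?case by (simp add: sort_key_def)
next
  case (Cons y ys)
  have "(\<lambda>x. insort_key (key x) y zs) \<in> measurable \<M> (count_space (lists D))" if "zs \<in> lists D" for zs
  proof (rule measurable_count_space_extend[OF subset_UNIV])
    show "(\<lambda>x. insort_key (key x) y zs) \<in> measurable \<M> (count_space UNIV)"
      using that Cons.hyps assms(1) by (intro measurable_insort_key) auto
  qed (use that Cons.hyps in \<open>auto simp: set_insort_key\<close>)
  then have "(\<lambda>x. insort_key (key x) y (sort_key (key x) ys)) \<in> measurable \<M> (count_space (lists D))"
    using Cons.IH by (rule measurable_compose_countable') auto
  then show ?case by simp
qed

definition valid_tasks :: "nat \<Rightarrow> (nat \<Rightarrow> real) \<Rightarrow> task set" where
  "valid_tasks W lam = {i \<in> {1..W}. 0 < lam i} \<times> UNIV"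

lemma set_arriving_tasks: "set (arriving_tasks W lam x T) \<subseteq> valid_tasks W lam"
  by (auto simp: arriving_tasks_def valid_tasks_def)

lemma measurable_arriving_tasks:
  assumes arrival: "\<And>\<tau>. \<tau> \<in> valid_tasks W lam \<Longrightarrow> (\<lambda>\<omega>. arrival (x \<omega>) \<tau>) \<in> borel_measurable \<M>"
  shows "(\<lambda>\<omega>. arriving_tasks W lam (x \<omega>) T) \<in> measurable \<M> (count_space (lists (valid_tasks W lam)))"
proof -
  define ks where "ks i \<omega> = sorted_list_of_set {k. arrival (x \<omega>) (i, k) \<le> T}" for i \<omega>
  define tasks where "tasks is \<omega> = [(i, k). i \<leftarrow> is, 0 < lam i, k \<leftarrow> ks i \<omega>]" for "is" \<omega>
  have tasks_simps: "tasks [] = (\<lambda>\<omega>. [])"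
    "tasks (i # is) = (\<lambda>\<omega>. (if 0 < lam i then map (Pair i) (ks i \<omega>) else []) @ tasks is \<omega>)" for i "is"
    by (auto simp: tasks_def fun_eq_iff)
  have tasks: "tasks is \<in> measurable \<M> (count_space UNIV)" if "set is \<subseteq> {1..W}" for "is"
    using that
  proof (induction "is")
    case Nil
    show ?case by (simp add: tasks_simps)
  next
    case (Cons i "is")
    have IH: "tasks is \<in> measurable \<M> (count_space UNIV)"
      by (rule Cons.IH) (use Cons.prems in simp)
    have append: "(\<lambda>\<omega>. l @ tasks is \<omega>) \<in> measurable \<M> (count_space UNIV)" for l
      using measurable_compose[OF IH, where g="(@) l" and L="count_space UNIV"] by simp
    show ?case
    proof (cases "0 < lam i")
      case True
      then have "(\<lambda>\<omega>. arrival (x \<omega>) (i, k)) \<in> borel_measurable \<M>" for k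
        using Cons.prems by (intro arrival) (auto simp: valid_tasks_def)
      then have "ks i \<in> measurable \<M> (count_space UNIV)"
        unfolding ks_def by (intro measurable_sorted_list_of_set) simp
      from measurable_compose_countable[where f="\<lambda>l \<omega>. map (Pair i) l @ tasks is \<omega>", OF append this]
      show ?thesis using True by (simp add: tasks_simps)
    qed (use append[of "[]"] in \<open>simp add: tasks_simps\<close>)
  qed
  have "set (tasks [1..<Suc W] \<omega>) \<subseteq> valid_tasks W lam" for \<omega>
    by (auto simp: tasks_def valid_tasks_def simp del: upt_Suc)
  then have tasks_lists: "tasks [1..<Suc W] \<omega> \<in> lists (valid_tasks W lam)" for \<omega>
    by (simp add: in_lists_conv_set subset_eq)
  have "tasks [1..<Suc W] \<in> measurable \<M> (count_space (lists (valid_tasks W lam)))"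
    by (rule measurable_count_space_extend[OF subset_UNIV _ tasks])
      (use tasks_lists in \<open>auto simp del: upt_Suc\<close>)
  then have "(\<lambda>\<omega>. sort_key (arrival (x \<omega>)) (tasks [1..<Suc W] \<omega>))
    \<in> measurable \<M> (count_space (lists (valid_tasks W lam)))"
    by (rule measurable_compose_countable'[where f="\<lambda>l \<omega>. sort_key (arrival (x \<omega>)) l", rotated])
      (auto intro: measurable_sort_key[OF arrival])
  then show ?thesis by (simp only: arriving_tasks_def tasks_def ks_def)
qed

definition history_measurable :: "'a measure \<Rightarrow> ('a \<Rightarrow> history) \<Rightarrow> bool" where
  "history_measurable \<M> h \<longleftrightarrow> (\<exists>n. (\<forall>\<omega>. length (h \<omega>) = n) \<and>
     (\<forall>i<n. (\<lambda>\<omega>. fst (h \<omega> ! i)) \<in> measurable \<M> (count_space UNIV) \<and>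
            (\<lambda>\<omega>. snd (h \<omega> ! i)) \<in> borel_measurable \<M>))"

lemma history_measurable_Nil: "history_measurable \<M> (\<lambda>_. [])"
  by (simp add: history_measurable_def)

lemma history_measurable_snoc:
  assumes "history_measurable \<M> h" "j \<in> measurable \<M> (count_space UNIV)" "d \<in> borel_measurable \<M>"
  shows "history_measurable \<M> (\<lambda>\<omega>. h \<omega> @ [(j \<omega>, d \<omega>)])"
  using assms unfolding history_measurable_def by (auto simp: nth_append less_Suc_eq)

lemma measurable_busy:
  assumes "history_measurable \<M> h" and [measurable]: "t \<in> borel_measurable \<M>"
  shows "Measurable.pred \<M> (\<lambda>\<omega>. busy (h \<omega>) (t \<omega>) j)"
proof -
  obtain n where n: "\<And>\<omega>. length (h \<omega>) = n"
    and "\<And>i. i < n \<Longrightarrow> (\<lambda>\<omega>. fst (h \<omega> ! i)) \<in> measurable \<M> (count_space UNIV)"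
        "\<And>i. i < n \<Longrightarrow> (\<lambda>\<omega>. snd (h \<omega> ! i)) \<in> borel_measurable \<M>"
    using assms(1) unfolding history_measurable_def by blast
  then have "Measurable.pred \<M> (\<lambda>\<omega>. \<exists>i\<in>{..<n}. fst (h \<omega> ! i) = j \<and> ereal (t \<omega>) < snd (h \<omega> ! i))"
    by (intro pred_intros_countable_bounded pred_intros_logic pred_eq_const1 borel_measurable_pred_less
        borel_measurable_ereal) auto
  moreover have "busy (h \<omega>) (t \<omega>) j \<longleftrightarrow> (\<exists>i\<in>{..<n}. fst (h \<omega> ! i) = j \<and> ereal (t \<omega>) < snd (h \<omega> ! i))" for \<omega>
  proof -
    have "busy (h \<omega>) (t \<omega>) j \<longleftrightarrow> (\<exists>x\<in>set (h \<omega>). fst x = j \<and> ereal (t \<omega>) < snd x)"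
      by (auto simp: busy_def queue_def filter_empty_conv case_prod_beta)
    also have "\<dots> \<longleftrightarrow> (\<exists>i\<in>{..<n}. fst (h \<omega> ! i) = j \<and> ereal (t \<omega>) < snd (h \<omega> ! i))"
      unfolding Bex_def in_set_conv_nth n lessThan_iff by blast
    finally show ?thesis .
  qed
  ultimately show ?thesis by simp
qed

lemma measurable_departure:
  assumes "history_measurable \<M> h" and [measurable]: "t \<in> borel_measurable \<M>" "s \<in> borel_measurable \<M>"
  shows "(\<lambda>\<omega>. departure (h \<omega>) (t \<omega>) j (s \<omega>)) \<in> borel_measurable \<M>"
proof -
  obtain n where n: "\<And>\<omega>. length (h \<omega>) = n"
    and "\<And>i. i < n \<Longrightarrow> (\<lambda>\<omega>. fst (h \<omega> ! i)) \<in> measurable \<M> (count_space UNIV)"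
        "\<And>i. i < n \<Longrightarrow> (\<lambda>\<omega>. snd (h \<omega> ! i)) \<in> borel_measurable \<M>"
    using assms(1) unfolding history_measurable_def by blast
  then have [measurable]: "(\<lambda>\<omega>. if fst (h \<omega> ! i) = j \<and> ereal (t \<omega>) < snd (h \<omega> ! i) then snd (h \<omega> ! i)
      else ereal (t \<omega>)) \<in> borel_measurable \<M>" if "i \<in> {..<n}" for i
    using that by (intro measurable_If pred_intros_logic pred_eq_const1 borel_measurable_pred_less
        borel_measurable_ereal predE) auto
  have "(\<lambda>\<omega>. sup (ereal (t \<omega>)) (SUP i\<in>{..<n}. if fst (h \<omega> ! i) = j \<and> ereal (t \<omega>) < snd (h \<omega> ! i) 
      then snd (h \<omega> ! i) else ereal (t \<omega>)) + s \<omega>) \<in> borel_measurable \<M>"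
    by measurable
  moreover have "departure (h \<omega>) (t \<omega>) j (s \<omega>) =
    sup (ereal (t \<omega>)) (SUP i\<in>{..<n}. if fst (h \<omega> ! i) = j \<and> ereal (t \<omega>) < snd (h \<omega> ! i) 
      then snd (h \<omega> ! i) else ereal (t \<omega>)) + s \<omega>" for \<omega>
  proof -
    let ?d = "\<lambda>i. if fst (h \<omega> ! i) = j \<and> ereal (t \<omega>) < snd (h \<omega> ! i) then snd (h \<omega> ! i) else ereal (t \<omega>)"
    have "Max (insert (ereal (t \<omega>)) (snd ` set (queue (h \<omega>) (t \<omega>) j))) = 
      Sup (insert (ereal (t \<omega>)) (snd ` set (queue (h \<omega>) (t \<omega>) j)))"
      by (intro Max_Sup) auto
    also have "\<dots> = Sup (insert (ereal (t \<omega>)) (?d ` {..<n}))"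
    proof (intro arg_cong[where f=Sup] equalityI subsetI)
      fix y assume "y \<in> insert (ereal (t \<omega>)) (snd ` set (queue (h \<omega>) (t \<omega>) j))"
      then show "y \<in> insert (ereal (t \<omega>)) (?d ` {..<n})"
      proof
        assume "y \<in> snd ` set (queue (h \<omega>) (t \<omega>) j)"
        then obtain x where "x \<in> set (h \<omega>)" "fst x = j" "ereal (t \<omega>) < snd x" "y = snd x"
          by (auto simp: queue_def case_prod_beta)
        then show ?thesis by (auto simp: in_set_conv_nth n)
      qed simp
    next
      fix y assume "y \<in> insert (ereal (t \<omega>)) (?d ` {..<n})"
      then show "y \<in> insert (ereal (t \<omega>)) (snd ` set (queue (h \<omega>) (t \<omega>) j))"
        by (auto simp: queue_def case_prod_beta n)
    qed
    finally show ?thesis by (simp add: departure_def)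
  qed
  ultimately show ?thesis by simp
qed

definition chosen_server ::
  "(task \<Rightarrow> nat set \<Rightarrow> nat) \<Rightarrow> (task \<Rightarrow> real) \<Rightarrow> history \<Rightarrow> task \<Rightarrow> nat" where
  "chosen_server policy a hist \<tau> = policy \<tau> {j. busy hist (a \<tau>) j}"

definition assign ::
  "(task \<Rightarrow> nat set \<Rightarrow> nat) \<Rightarrow> (task \<Rightarrow> real) \<Rightarrow> (task \<Rightarrow> nat \<Rightarrow> ereal) \<Rightarrow> history \<Rightarrow> task \<Rightarrow> history"
where
  "assign policy a s hist \<tau> =
     (let j = chosen_server policy a hist \<tau> in hist @ [(j, departure hist (a \<tau>) j (s \<tau> j))])"

abbreviation history_after where
  "history_after policy a s \<equiv> foldl (assign policy a s) []"

lemma assigned_to_busy_iff: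
  "assigned_to_busy policy a s hist L \<longleftrightarrow>
     (\<exists>n<length L. let h = foldl (assign policy a s) hist (take n L)
        in busy h (a (L ! n)) (chosen_server policy a h (L ! n)))"
proof (induction L arbitrary: hist)
  case (Cons \<tau> L)
  have "assigned_to_busy policy a s hist (\<tau> # L) \<longleftrightarrow>
      busy hist (a \<tau>) (chosen_server policy a hist \<tau>) \<or>
      assigned_to_busy policy a s (assign policy a s hist \<tau>) L"
    by (simp add: Let_def chosen_server_def assign_def)
  then show ?case
    by (auto simp: Cons.IH less_Suc_eq_0_disj Let_def)
qed simp

locale measurable_dynamics =
  fixes \<M> :: "'a measure"
    and D D' :: "task set"
    and policy :: "'a \<Rightarrow> task \<Rightarrow> nat set \<Rightarrow> nat"
    and a :: "'a \<Rightarrow> task \<Rightarrow> real"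
    and s :: "'a \<Rightarrow> task \<Rightarrow> nat \<Rightarrow> ereal"
  assumes D'_subset: "D' \<subseteq> D"
    and measurable_policy:
      "\<And>\<tau> B. \<lbrakk>\<tau> \<in> D; \<And>j. Measurable.pred \<M> (\<lambda>\<omega>. j \<in> B \<omega>)\<rbrakk>
         \<Longrightarrow> (\<lambda>\<omega>. policy \<omega> \<tau> (B \<omega>)) \<in> measurable \<M> (count_space UNIV)"
    and measurable_a: "\<And>\<tau>. \<tau> \<in> D \<Longrightarrow> (\<lambda>\<omega>. a \<omega> \<tau>) \<in> borel_measurable \<M>"
    and measurable_s: "\<And>\<tau> j. \<tau> \<in> D' \<Longrightarrow> (\<lambda>\<omega>. s \<omega> \<tau> j) \<in> borel_measurable \<M>"
begin

lemma measurable_chosen_server: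
  assumes "history_measurable \<M> h" "\<tau> \<in> D"
  shows "(\<lambda>\<omega>. chosen_server (policy \<omega>) (a \<omega>) (h \<omega>) \<tau>) \<in> measurable \<M> (count_space UNIV)"
  unfolding chosen_server_def using assms
  by (intro measurable_policy) (auto intro: measurable_busy measurable_a)

lemma history_measurable_assign:
  assumes "history_measurable \<M> h" "\<tau> \<in> D'"
  shows "history_measurable \<M> (\<lambda>\<omega>. assign (policy \<omega>) (a \<omega>) (s \<omega>) (h \<omega>) \<tau>)"
proof -
  have \<tau>: "\<tau> \<in> D" using assms(2) D'_subset by blast
  show ?thesis
    unfolding assign_def Let_def
    by (intro history_measurable_snoc measurable_chosen_server[OF assms(1) \<tau>] assms(1)
        measurable_compose_countable[OF _ measurable_chosen_server[OF assms(1) \<tau>], where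
          f="\<lambda>j \<omega>. departure (h \<omega>) (a \<omega> \<tau>) j (s \<omega> \<tau> j)"]
        measurable_departure measurable_a[OF \<tau>] measurable_s assms(2))
qed

lemma history_measurable_foldl:
  assumes "L \<in> lists D'"
  shows "history_measurable \<M> (\<lambda>\<omega>. history_after (policy \<omega>) (a \<omega>) (s \<omega>) L)"
  using assms
proof (induction L rule: rev_induct)
  case (snoc \<tau> L)
  then show ?case using history_measurable_assign[of "\<lambda>\<omega>. history_after (policy \<omega>) (a \<omega>) (s \<omega>) L"] by simp
qed (simp add: history_measurable_Nil)

lemma measurable_chosen_server_after:
  assumes "L \<in> measurable \<M> (count_space (lists D'))" "\<tau> \<in> D"
  shows "(\<lambda>\<omega>. chosen_server (policy \<omega>) (a \<omega>) (history_after (policy \<omega>) (a \<omega>) (s \<omega>) (L \<omega>)) \<tau>)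
    \<in> measurable \<M> (count_space UNIV)"
  by (rule measurable_compose_countable'[OF _ assms(1), where
      f="\<lambda>L \<omega>. chosen_server (policy \<omega>) (a \<omega>) (history_after (policy \<omega>) (a \<omega>) (s \<omega>) L) \<tau>"])
    (use assms(2) in \<open>auto intro!: measurable_chosen_server history_measurable_foldl\<close>)

lemma pred_assigned_to_busy:
  assumes "L \<in> measurable \<M> (count_space (lists D'))"
  shows "Measurable.pred \<M> (\<lambda>\<omega>. assigned_to_busy (policy \<omega>) (a \<omega>) (s \<omega>) [] (L \<omega>))"
proof (rule measurable_compose_countable'[OF _ assms, where
      f="\<lambda>L \<omega>. assigned_to_busy (policy \<omega>) (a \<omega>) (s \<omega>) [] L"])
  fix L assume L: "L \<in> lists D'"
  have "Measurable.pred \<M> (\<lambda>\<omega>. busy (history_after (policy \<omega>) (a \<omega>) (s \<omega>) (take n L)) (a \<omega> (L ! n))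
        (chosen_server (policy \<omega>) (a \<omega>) (history_after (policy \<omega>) (a \<omega>) (s \<omega>) (take n L)) (L ! n)))"
    if "n < length L" for n
  proof -
    have *: "take n L \<in> lists D'" "L ! n \<in> D"
      using L that D'_subset by (auto simp: in_lists_conv_set dest: in_set_takeD)
    show ?thesis
      by (rule measurable_compose_countable[OF _
          measurable_chosen_server[OF history_measurable_foldl[OF *(1)] *(2)], where
          f="\<lambda>j \<omega>. busy (history_after (policy \<omega>) (a \<omega>) (s \<omega>) (take n L)) (a \<omega> (L ! n)) j"])
        (rule measurable_busy[OF history_measurable_foldl[OF *(1)] measurable_a[OF *(2)]])
  qed
  then show "Measurable.pred \<M> (\<lambda>\<omega>. assigned_to_busy (policy \<omega>) (a \<omega>) (s \<omega>) [] L)"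
    unfolding assigned_to_busy_iff Let_def
    by (intro pred_intros_countable pred_intros_conj1')
qed simp

end

lemma measurable_pick:
  fixes A :: "'a \<Rightarrow> nat set"
  assumes "\<And>j. Measurable.pred \<M> (\<lambda>\<omega>. j \<in> A \<omega>)" "\<And>\<omega>. A \<omega> \<subseteq> {..n}"
    and [measurable]: "u \<in> borel_measurable \<M>"
  shows "(\<lambda>\<omega>. pick (A \<omega>) (u \<omega>)) \<in> measurable \<M> (count_space UNIV)"
proof -
  have "A \<in> measurable \<M> (count_space (Pow {..n}))"
  proof (subst measurable_count_space_eq2, simp, intro conjI ballI)
    fix B assume "B \<in> Pow {..n}"
    then have "A -` {B} \<inter> space \<M> = {\<omega> \<in> space \<M>. \<forall>j. j \<in> A \<omega> \<longleftrightarrow> j \<in> B}"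
      by auto
    also have "\<dots> \<in> sets \<M>" using assms(1) by measurable
    finally show "A -` {B} \<inter> space \<M> \<in> sets \<M>" .
  qed (use assms(2) in auto)
  moreover have "(\<lambda>\<omega>. pick B (u \<omega>)) \<in> measurable \<M> (count_space UNIV)" for B
  proof -
    have "(\<lambda>\<omega>. \<lfloor>u \<omega> * real (card B)\<rfloor>) \<in> measurable \<M> (count_space UNIV)"
      by measurable
    from measurable_compose[OF this, of "\<lambda>z. sorted_list_of_set B ! nat z" "count_space UNIV"]
    show ?thesis by (simp add: pick_def)
  qed
  ultimately show ?thesis
    by (intro measurable_compose_countable'[where g=A and I="Pow {..n}" and f="\<lambda>B \<omega>. pick B (u \<omega>)"])
       (auto intro: countable_finite)
qed

lemma measurable_jiq_policy:
  assumes "\<And>m. pool m \<subseteq> {..n}" and "\<And>j. Measurable.pred \<M> (\<lambda>\<omega>. j \<in> B \<omega>)"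
    and z: "(\<lambda>\<omega>. z \<omega> i k) \<in> measurable \<M> (count_space UNIV)"
    and "(\<lambda>\<omega>. u \<omega> i k) \<in> borel_measurable \<M>"
  shows "(\<lambda>\<omega>. jiq_policy pool (z \<omega>) (u \<omega>) (i, k) (B \<omega>)) \<in> measurable \<M> (count_space UNIV)"
proof -
  have "(\<lambda>\<omega>. pick (if pool m - B \<omega> \<noteq> {} then pool m - B \<omega> else pool m) (u \<omega> i k))
    \<in> measurable \<M> (count_space UNIV)" for m
  proof (rule measurable_pick[where n=n])
    have [measurable]: "Measurable.pred \<M> (\<lambda>\<omega>. j \<in> B \<omega>)" for j by fact
    have "Measurable.pred \<M> (\<lambda>\<omega>. if \<exists>j. j \<in> pool m \<and> j \<notin> B \<omega> then j \<in> pool m \<and> j \<notin> B \<omega> else j \<in> pool m)"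
      for j by measurable
    then show "Measurable.pred \<M> (\<lambda>\<omega>. j \<in> (if pool m - B \<omega> \<noteq> {} then pool m - B \<omega> else pool m))" for j
      by (rule measurable_cong[THEN iffD1, rotated]) auto
  qed (use assms in auto)
  then show ?thesis
    unfolding jiq_policy_def Let_def prod.case
    by (rule measurable_compose_countable[OF _ z, where
        f="\<lambda>m \<omega>. pick (if pool m - B \<omega> \<noteq> {} then pool m - B \<omega> else pool m) (u \<omega> i k)"])
qed


section \<open>Independent groups of coordinates\<close>

locale indep_coords = prob_space M for M :: "'a measure" +
  fixes V :: "'c \<Rightarrow> 'a \<Rightarrow> real" and I :: "'c set"
  assumes indep: "indep_vars (\<lambda>_. borel) V I"
begin

definition gen :: "'c set \<Rightarrow> 'a measure" where
  "gen K = sigma (space M) (\<Union>c\<in>K. {V c -` A \<inter> space M | A. A \<in> sets borel})"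

lemma space_gen [simp]: "space (gen K) = space M"
  unfolding gen_def by (rule space_measure_of) auto

lemma sets_gen: "sets (gen K) = sigma_sets (space M) (\<Union>c\<in>K. {V c -` A \<inter> space M | A. A \<in> sets borel})"
  unfolding gen_def by (rule sets_measure_of) auto

lemma measurable_gen_coord: "c \<in> K \<Longrightarrow> V c \<in> borel_measurable (gen K)"
  by (rule measurableI) (auto simp: sets_gen)

lemma sets_gen_mono: "K \<subseteq> K' \<Longrightarrow> sets (gen K) \<subseteq> sets (gen K')"
  unfolding sets_gen by (rule sigma_sets_mono') auto

lemma measurable_gen_mono: "f \<in> measurable (gen K) N \<Longrightarrow> K \<subseteq> K' \<Longrightarrow> f \<in> measurable (gen K') N"
  using sets_gen_mono[of K K'] by (auto simp: measurable_def)

lemma coord_measurable: "c \<in> I \<Longrightarrow> V c \<in> borel_measurable M"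
  using indep by (auto simp: indep_vars_def)

lemma sets_gen_subset: "K \<subseteq> I \<Longrightarrow> sets (gen K) \<subseteq> sets M"
  unfolding sets_gen by (rule sets.sigma_sets_subset) (auto dest: coord_measurable intro: measurable_sets)

lemma measurable_gen_imp: "f \<in> measurable (gen K) N \<Longrightarrow> K \<subseteq> I \<Longrightarrow> f \<in> measurable M N"
  using sets_gen_subset[of K] by (auto simp: measurable_def)

lemma prob_gen_Int:
  assumes "A \<in> sets (gen K)" "B \<in> sets (gen K')" and K: "K \<subseteq> I" "K' \<subseteq> I" "K \<inter> K' = {}"
  shows "prob (A \<inter> B) = prob A * prob B"
proof -
  let ?E = "\<lambda>c. {V c -` A \<inter> space M | A. A \<in> sets borel}"
  have "indep_sets (\<lambda>b. sigma_sets (space M) (\<Union>c\<in>case_bool K K' b. ?E c)) UNIV"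
  proof (rule indep_sets_collect_sigma)
    show "indep_sets ?E (\<Union>b\<in>UNIV. case_bool K K' b)"
      using indep K unfolding indep_vars_def2
      by (auto simp: UNIV_bool intro: indep_sets_mono_index)
    show "Int_stable (?E i)" for i
    proof (rule Int_stableI)
      fix a b assume "a \<in> ?E i" "b \<in> ?E i"
      then obtain A B where "a = V i -` A \<inter> space M" "b = V i -` B \<inter> space M" "A \<in> sets borel" "B \<in> sets borel"
        by blast
      then have "a \<inter> b = V i -` (A \<inter> B) \<inter> space M" "A \<inter> B \<in> sets borel"
        by auto
      then show "a \<inter> b \<in> ?E i" by blast
    qed
    show "disjoint_family_on (case_bool K K') UNIV"
      using K(3) by (auto simp: disjoint_family_on_def split: bool.splits)
  qed
  then have "indep_set (sets (gen K)) (sets (gen K'))"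
    unfolding indep_set_def sets_gen
    by (rule indep_sets_cong[THEN iffD1, rotated 2]) (auto split: bool.split)
  then show ?thesis using assms by (simp add: indep_sets2_eq)
qed

lemma nn_integral_freeze:
  assumes F: "F \<in> borel_measurable (gen K \<Otimes>\<^sub>M N)" and g: "g \<in> measurable (gen K') N"
    and K: "K \<subseteq> I" "K' \<subseteq> I" "K \<inter> K' = {}"
  shows "(\<integral>\<^sup>+\<omega>. F (\<omega>, g \<omega>) \<partial>M) = (\<integral>\<^sup>+\<omega>. (\<integral>\<^sup>+y. F (\<omega>, y) \<partial>distr M N g) \<partial>M)"
proof -
  have id: "(\<lambda>\<omega>. \<omega>) \<in> measurable M (gen K)"
    using sets_gen_subset[OF K(1)] by (intro measurableI) auto
  have g': "g \<in> measurable M N" using g K by (blast intro: measurable_gen_imp)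
  interpret D: prob_space "distr M N g" by (rule prob_space_distr) fact
  interpret E: prob_space "distr M (gen K) (\<lambda>\<omega>. \<omega>)" by (rule prob_space_distr) fact
  have eq: "distr M (gen K) (\<lambda>\<omega>. \<omega>) \<Otimes>\<^sub>M distr M N g = distr M (gen K \<Otimes>\<^sub>M N) (\<lambda>\<omega>. (\<omega>, g \<omega>))"
  proof (rule pair_measure_eqI[OF E.sigma_finite_measure D.sigma_finite_measure])
    fix A B assume AB: "A \<in> sets (distr M (gen K) (\<lambda>\<omega>. \<omega>))" "B \<in> sets (distr M N g)"
    then have A: "A \<in> sets (gen K)" "A \<subseteq> space M" "A \<in> sets M" and B: "g -` B \<inter> space M \<in> sets (gen K')"
      using sets.sets_into_space[of A "gen K"] sets_gen_subset[OF K(1)] measurable_sets[OF g, of B] by auto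
    have "emeasure M A * emeasure M (g -` B \<inter> space M) = emeasure M (A \<inter> (g -` B \<inter> space M))"
      using prob_gen_Int[OF A(1) B K] by (simp add: emeasure_eq_measure ennreal_mult'')
    moreover have "(\<lambda>\<omega>. (\<omega>, g \<omega>)) -` (A \<times> B) \<inter> space M = A \<inter> (g -` B \<inter> space M)"
      using A by auto
    ultimately show "emeasure (distr M (gen K) (\<lambda>\<omega>. \<omega>)) A * emeasure (distr M N g) B =
        emeasure (distr M (gen K \<Otimes>\<^sub>M N) (\<lambda>\<omega>. (\<omega>, g \<omega>))) (A \<times> B)"
      using id g' AB A by (simp add: emeasure_distr measurable_Pair Int_absorb2)
  qed simp
  have "(\<integral>\<^sup>+\<omega>. F (\<omega>, g \<omega>) \<partial>M) = (\<integral>\<^sup>+z. F z \<partial>distr M (gen K \<Otimes>\<^sub>M N) (\<lambda>\<omega>. (\<omega>, g \<omega>)))"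
    by (rule nn_integral_distr[symmetric]) (use id g' F in \<open>auto intro: measurable_Pair\<close>)
  also have "\<dots> = (\<integral>\<^sup>+\<omega>. (\<integral>\<^sup>+y. F (\<omega>, y) \<partial>distr M N g) \<partial>distr M (gen K) (\<lambda>\<omega>. \<omega>))"
    unfolding eq[symmetric] by (rule D.nn_integral_fst[symmetric]) (use F in simp)
  also have "\<dots> = (\<integral>\<^sup>+\<omega>. (\<integral>\<^sup>+y. F (\<omega>, y) \<partial>distr M N g) \<partial>M)"
    by (rule nn_integral_distr[OF id]) (use F in \<open>auto intro!: D.borel_measurable_nn_integral_fst\<close>)
  finally show ?thesis .
qed

lemma nn_integral_mult_indep:
  assumes [measurable]: "F \<in> borel_measurable (gen K)" and g: "g \<in> borel_measurable (gen K')"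
    and K: "K \<subseteq> I" "K' \<subseteq> I" "K \<inter> K' = {}"
  shows "(\<integral>\<^sup>+\<omega>. F \<omega> * g \<omega> \<partial>M) = (\<integral>\<^sup>+\<omega>. F \<omega> \<partial>M) * (\<integral>\<^sup>+\<omega>. g \<omega> \<partial>M :: ennreal)"
proof -
  have [measurable]: "F \<in> borel_measurable M" "g \<in> borel_measurable M"
    using assms by (blast intro: measurable_gen_imp)+
  have "(\<integral>\<^sup>+\<omega>. (case (\<omega>, g \<omega>) of (\<omega>, y) \<Rightarrow> F \<omega> * y) \<partial>M) =
      (\<integral>\<^sup>+\<omega>. (\<integral>\<^sup>+y. (case (\<omega>, y) of (\<omega>, y) \<Rightarrow> F \<omega> * y) \<partial>distr M borel g) \<partial>M)"
    by (rule nn_integral_freeze[OF _ g K]) measurable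
  then show ?thesis
    by (simp add: nn_integral_cmult nn_integral_distr nn_integral_multc)
qed

lemma nn_integral_tail_indep:
  assumes [measurable]: "F \<in> borel_measurable (gen K)" "t \<in> borel_measurable (gen K)"
    and K: "K \<subseteq> I" "c \<in> I" "c \<notin> K"
  shows "(\<integral>\<^sup>+\<omega>. F \<omega> * indicator {\<omega>. t \<omega> < V c \<omega>} \<omega> \<partial>M) =
    (\<integral>\<^sup>+\<omega>. F \<omega> * emeasure M {\<omega>' \<in> space M. t \<omega> < V c \<omega>'} \<partial>M)"
proof -
  have [measurable]: "V c \<in> borel_measurable M" by (rule coord_measurable) fact
  have "(\<integral>\<^sup>+\<omega>. (case (\<omega>, V c \<omega>) of (\<omega>, y) \<Rightarrow> F \<omega> * indicator {t \<omega><..} y) \<partial>M) =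
      (\<integral>\<^sup>+\<omega>. (\<integral>\<^sup>+y. (case (\<omega>, y) of (\<omega>, y) \<Rightarrow> F \<omega> * indicator {t \<omega><..} y) \<partial>distr M borel (V c)) \<partial>M)"
  proof (rule nn_integral_freeze[where K'="{c}"])
    have "(\<lambda>p. F (fst p) * indicator {p. t (fst p) < snd p} p) \<in> borel_measurable (gen K \<Otimes>\<^sub>M borel)"
      by measurable
    then show "(\<lambda>(\<omega>, y). F \<omega> * indicator {t \<omega><..} y) \<in> borel_measurable (gen K \<Otimes>\<^sub>M borel)"
      by (rule measurable_cong[THEN iffD1, rotated]) (auto split: split_indicator)
  qed (use K in \<open>auto intro: measurable_gen_coord\<close>)
  moreover have "(\<integral>\<^sup>+y. F \<omega> * indicator {t \<omega><..} y \<partial>distr M borel (V c)) =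
      F \<omega> * emeasure M {\<omega>' \<in> space M. t \<omega> < V c \<omega>'}" for \<omega>
    by (simp add: nn_integral_cmult emeasure_distr vimage_def Int_def conj_commute)
  moreover have "indicator {t \<omega><..} (V c \<omega>) = (indicator {\<omega>. t \<omega> < V c \<omega>} \<omega> :: ennreal)" for \<omega>
    by (simp split: split_indicator)
  ultimately show ?thesis by simp
qed

end


section \<open>Campbell's formulas for a Poisson process\<close>

lemma suminf_erlang_density:
  assumes "0 < l"
  shows "(\<Sum>k. ennreal (erlang_density k l x)) = ennreal l * indicator {0..} x"
proof (cases "x < 0")
  case False
  have "(\<lambda>k. l * exp (- l * x) * ((l * x) ^ k /\<^sub>R fact k)) sums (l * exp (- l * x) * exp (l * x))"
    by (intro sums_mult exp_converges)
  moreover have "l * exp (- l * x) * ((l * x) ^ k /\<^sub>R fact k) = erlang_density k l x" for k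
    using False by (simp add: erlang_density_def power_mult_distrib field_simps)
  moreover have "l * exp (- l * x) * exp (l * x) = l"
    by (simp add: exp_minus)
  ultimately have "(\<lambda>k. erlang_density k l x) sums l" by (simp only:)
  then have "(\<Sum>k. ennreal (erlang_density k l x)) = ennreal l"
    using assms by (intro suminf_ennreal_eq) auto
  then show ?thesis using False by simp
qed (simp add: erlang_density_def)

lemma suminf_ennreal_swap: "(\<Sum>i. \<Sum>j. f i j) = (\<Sum>j. \<Sum>i. f i j :: ennreal)" for f :: "nat \<Rightarrow> nat \<Rightarrow> ennreal"
  using nn_integral_suminf[of "\<lambda>j i. f i j" "count_space (UNIV::nat set)"]
  by (simp add: nn_integral_count_space_nat)

lemma suminf_offdiag_symmetric:
  fixes f :: "nat \<Rightarrow> nat \<Rightarrow> ennreal"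
  assumes sym: "\<And>i j. f i j = f j i"
  shows "(\<Sum>i. \<Sum>j. if i \<noteq> j then f i j else 0) = 2 * (\<Sum>i. \<Sum>d. f i (i + Suc d))"
proof -
  have up: "(\<Sum>j. if i < j then f i j else 0) = (\<Sum>d. f i (i + Suc d))" for i
  proof -
    have "(\<Sum>j. if i < j then f i j else 0) = (\<Sum>d. if i < d + Suc i then f i (d + Suc i) else 0) +
       (\<Sum>j<Suc i. if i < j then f i j else 0)"
      by (rule suminf_offset) auto
    also have "(\<Sum>j<Suc i. if i < j then f i j else 0) = 0" by (intro sum.neutral) auto
    finally show ?thesis by (simp add: add.commute)
  qed
  have "(\<Sum>i. \<Sum>j. if i \<noteq> j then f i j else 0) =
      (\<Sum>i. \<Sum>j. (if i < j then f i j else 0) + (if j < i then f j i else 0))"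
    by (intro suminf_cong) (auto simp: sym)
  also have "\<dots> = (\<Sum>i. \<Sum>j. if i < j then f i j else 0) + (\<Sum>i. \<Sum>j. if j < i then f j i else 0)"
    by (simp add: suminf_add[symmetric])
  also have "(\<Sum>i. \<Sum>j. if j < i then f j i else 0) = (\<Sum>j. \<Sum>i. if j < i then f j i else 0)"
    by (rule suminf_ennreal_swap)
  finally show ?thesis by (simp add: up mult_2)
qed

lemma nn_integral_ordered_pairs:
  fixes g :: "real \<Rightarrow> ennreal"
  assumes [measurable]: "g \<in> borel_measurable borel"
  shows "2 * (\<integral>\<^sup>+s. (\<integral>\<^sup>+u. g s * indicator {0..} s * (g (s + u) * indicator {0..} u) \<partial>lborel) \<partial>lborel) =
    (\<integral>\<^sup>+s. g s * indicator {0..} s \<partial>lborel)\<^sup>2"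
proof -
  let ?g = "\<lambda>s. g s * indicator {0..} s"
  have "(\<integral>\<^sup>+u. g s * indicator {0..} s * (g (s + u) * indicator {0..} u) \<partial>lborel) =
      (\<integral>\<^sup>+t. ?g s * ?g t * indicator {s..} t \<partial>lborel)" for s
  proof -
    have "(\<integral>\<^sup>+t. ?g s * ?g t * indicator {s..} t \<partial>lborel) =
      (\<integral>\<^sup>+u. ?g s * ?g (s + 1 * u) * indicator {s..} (s + 1 * u) \<partial>lborel)"
      by (subst nn_integral_real_affine[where c=1 and t=s]) auto
    also have "\<dots> = (\<integral>\<^sup>+u. ?g s * (g (s + u) * indicator {0..} u) \<partial>lborel)"
      by (intro nn_integral_cong) (auto split: split_indicator)
    finally show ?thesis by simp
  qed
  then have eq: "(\<integral>\<^sup>+s. (\<integral>\<^sup>+u. g s * indicator {0..} s * (g (s + u) * indicator {0..} u) \<partial>lborel) \<partial>lborel) =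
      (\<integral>\<^sup>+s. (\<integral>\<^sup>+t. ?g s * ?g t * indicator {s..} t \<partial>lborel) \<partial>lborel)" (is "?A = ?B")
    by simp
  have "?B = (\<integral>\<^sup>+t. (\<integral>\<^sup>+s. ?g s * ?g t * indicator {p. fst p \<le> snd p} (s, t) \<partial>lborel) \<partial>lborel)"
    by (subst lborel_pair.Fubini') (auto intro!: nn_integral_cong split: split_indicator)
  also have "\<dots> = (\<integral>\<^sup>+s. (\<integral>\<^sup>+t. ?g s * ?g t * indicator {..s} t \<partial>lborel) \<partial>lborel)"
    by (auto intro!: nn_integral_cong simp: mult.commute split: split_indicator)
  finally have "2 * ?B = ?B + (\<integral>\<^sup>+s. (\<integral>\<^sup>+t. ?g s * ?g t * indicator {..s} t \<partial>lborel) \<partial>lborel)"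
    by (simp add: mult_2)
  also have "\<dots> = (\<integral>\<^sup>+s. (\<integral>\<^sup>+t. ?g s * ?g t * indicator {s..} t + ?g s * ?g t * indicator {..s} t \<partial>lborel) \<partial>lborel)"
  proof -
    have [measurable]: "(\<lambda>s. \<integral>\<^sup>+t. ?g s * ?g t * indicator {p. fst p \<le> snd p} (s, t) \<partial>lborel) \<in> borel_measurable borel"
      "(\<lambda>s. \<integral>\<^sup>+t. ?g s * ?g t * indicator {p. snd p \<le> fst p} (s, t) \<partial>lborel) \<in> borel_measurable borel"
      by measurable
    have "(\<lambda>s. \<integral>\<^sup>+t. ?g s * ?g t * indicator {s..} t \<partial>lborel) =
       (\<lambda>s. \<integral>\<^sup>+t. ?g s * ?g t * indicator {p. fst p \<le> snd p} (s, t) \<partial>lborel)"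
      "(\<lambda>s. \<integral>\<^sup>+t. ?g s * ?g t * indicator {..s} t \<partial>lborel) =
       (\<lambda>s. \<integral>\<^sup>+t. ?g s * ?g t * indicator {p. snd p \<le> fst p} (s, t) \<partial>lborel)"
      by (auto intro!: ext nn_integral_cong split: split_indicator)
    then show ?thesis
      by (subst nn_integral_add[symmetric]; (subst nn_integral_add)?) simp_all
  qed
  also have "\<dots> = (\<integral>\<^sup>+s. (\<integral>\<^sup>+t. ?g s * ?g t \<partial>lborel) \<partial>lborel)"
  proof (rule nn_integral_cong, rule nn_integral_cong_AE)
    fix s :: real
    show "AE t in lborel. ?g s * ?g t * indicator {s..} t + ?g s * ?g t * indicator {..s} t = ?g s * ?g t"
      using AE_lborel_singleton[of s] by eventually_elim (auto split: split_indicator)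
  qed
  also have "\<dots> = (\<integral>\<^sup>+s. ?g s \<partial>lborel)\<^sup>2"
    by (simp add: nn_integral_cmult nn_integral_multc power2_eq_square)
  finally show ?thesis unfolding eq .
qed

locale exponential_renewal = prob_space M for M :: "'a measure" +
  fixes X :: "nat \<Rightarrow> 'a \<Rightarrow> real" and l :: real
  assumes l_pos: "0 < l"
    and indep_X: "indep_vars (\<lambda>_. borel) X UNIV"
    and exponential_X: "\<And>k. distributed M lborel (X k) (exponential_density l)"
begin

sublocale indep_coords M X UNIV
  by standard (rule indep_X)

lemma distributed_sum_X:
  assumes "finite K" "card K = Suc n"
  shows "distributed M lborel (\<lambda>\<omega>. \<Sum>k\<in>K. X k \<omega>) (erlang_density n l)"
  using exponential_distributed_sum[of K l X] assms l_pos exponential_X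
    indep_vars_subset[OF indep_X, of K] by force

lemma campbell_first:
  assumes [measurable]: "g \<in> borel_measurable borel"
  shows "(\<Sum>k. \<integral>\<^sup>+\<omega>. g (\<Sum>j\<le>k. X j \<omega>) \<partial>M) = ennreal l * (\<integral>\<^sup>+x. g x * indicator {0..} x \<partial>lborel)"
proof -
  have "(\<Sum>k. \<integral>\<^sup>+\<omega>. g (\<Sum>j\<le>k. X j \<omega>) \<partial>M) = (\<Sum>k. \<integral>\<^sup>+x. ennreal (erlang_density k l x) * g x \<partial>lborel)"
    by (intro suminf_cong distributed_nn_integral[symmetric] distributed_sum_X) auto
  also have "\<dots> = (\<integral>\<^sup>+x. (\<Sum>k. ennreal (erlang_density k l x) * g x) \<partial>lborel)"
    by (rule nn_integral_suminf[symmetric]) simp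
  also have "\<dots> = (\<integral>\<^sup>+x. ennreal l * (g x * indicator {0..} x) \<partial>lborel)"
    by (simp add: ennreal_suminf_multc suminf_erlang_density[OF l_pos] ac_simps)
  also have "\<dots> = ennreal l * (\<integral>\<^sup>+x. g x * indicator {0..} x \<partial>lborel)"
    by (rule nn_integral_cmult) simp
  finally show ?thesis .
qed

lemma nn_integral_two_arrivals:
  assumes [measurable]: "g \<in> borel_measurable borel"
  shows "(\<integral>\<^sup>+\<omega>. g (\<Sum>j\<le>k. X j \<omega>) * g (\<Sum>j\<le>k + Suc d. X j \<omega>) \<partial>M) =
    (\<integral>\<^sup>+s. (\<integral>\<^sup>+u. ennreal (erlang_density k l s) * g s * (ennreal (erlang_density d l u) * g (s + u)) \<partial>lborel) \<partial>lborel)"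
proof -
  let ?a = "\<lambda>\<omega>. \<Sum>j\<le>k. X j \<omega>" and ?b = "\<lambda>\<omega>. \<Sum>j\<in>{k<..k + Suc d}. X j \<omega>"
  have a: "distributed M lborel ?a (erlang_density k l)" and b: "distributed M lborel ?b (erlang_density d l)"
    by (intro distributed_sum_X; simp)+
  have [measurable]: "?a \<in> borel_measurable (gen {..k})" "?b \<in> borel_measurable (gen {k<..k + Suc d})"
    by (auto intro!: borel_measurable_sum measurable_gen_coord)
  have "(\<Sum>j\<le>k + Suc d. X j \<omega>) = ?a \<omega> + ?b \<omega>" for \<omega>
  proof -
    have "{..k + Suc d} = {..k} \<union> {k<..k + Suc d}" by auto
    then show ?thesis by (simp only: sum.union_disjoint[OF finite_atMost finite_greaterThanAtMost ivl_disj_int(3)])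
  qed
  then have "(\<integral>\<^sup>+\<omega>. g (?a \<omega>) * g (\<Sum>j\<le>k + Suc d. X j \<omega>) \<partial>M) =
      (\<integral>\<^sup>+\<omega>. (case (\<omega>, ?b \<omega>) of (\<omega>, y) \<Rightarrow> g (?a \<omega>) * g (?a \<omega> + y)) \<partial>M)"
    by simp
  also have "\<dots> = (\<integral>\<^sup>+\<omega>. (\<integral>\<^sup>+y. (case (\<omega>, y) of (\<omega>, y) \<Rightarrow> g (?a \<omega>) * g (?a \<omega> + y)) \<partial>distr M borel ?b) \<partial>M)"
    by (rule nn_integral_freeze[where K="{..k}" and K'="{k<..k + Suc d}"]) (measurable, auto)
  also have "\<dots> = (\<integral>\<^sup>+\<omega>. (\<integral>\<^sup>+u. ennreal (erlang_density d l u) * (g (?a \<omega>) * g (?a \<omega> + u)) \<partial>lborel) \<partial>M)"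
    using b by (intro nn_integral_cong)
      (simp add: distributed_nn_integral nn_integral_distr distributed_measurable[OF b, simplified])
  also have "\<dots> = (\<integral>\<^sup>+s. ennreal (erlang_density k l s) *
      (\<integral>\<^sup>+u. ennreal (erlang_density d l u) * (g s * g (s + u)) \<partial>lborel) \<partial>lborel)"
    by (rule distributed_nn_integral[OF a, symmetric]) simp
  also have "\<dots> = (\<integral>\<^sup>+s. (\<integral>\<^sup>+u. ennreal (erlang_density k l s) * (ennreal (erlang_density d l u) * (g s * g (s + u))) \<partial>lborel) \<partial>lborel)"
    by (simp add: nn_integral_cmult)
  finally show ?thesis by (simp add: ac_simps)
qed

lemma campbell_second:
  assumes [measurable]: "g \<in> borel_measurable borel"
  shows "(\<Sum>k. \<Sum>k'. if k \<noteq> k' then \<integral>\<^sup>+\<omega>. g (\<Sum>j\<le>k. X j \<omega>) * g (\<Sum>j\<le>k'. X j \<omega>) \<partial>M else 0) =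
    (ennreal l * (\<integral>\<^sup>+x. g x * indicator {0..} x \<partial>lborel))\<^sup>2"
proof -
  have "(\<Sum>k. \<Sum>d. \<integral>\<^sup>+\<omega>. g (\<Sum>j\<le>k. X j \<omega>) * g (\<Sum>j\<le>k + Suc d. X j \<omega>) \<partial>M) =
    (\<Sum>k. \<integral>\<^sup>+s. (\<integral>\<^sup>+u. ennreal (erlang_density k l s) * g s * (ennreal l * indicator {0..} u * g (s + u)) \<partial>lborel) \<partial>lborel)"
    unfolding nn_integral_two_arrivals[OF assms]
    by (simp add: nn_integral_suminf[symmetric] ennreal_suminf_cmult ennreal_suminf_multc suminf_erlang_density[OF l_pos])
  also have "\<dots> = (\<integral>\<^sup>+s. (\<integral>\<^sup>+u. ennreal l * indicator {0..} s * g s * (ennreal l * indicator {0..} u * g (s + u)) \<partial>lborel) \<partial>lborel)"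
    by (simp add: nn_integral_suminf[symmetric] ennreal_suminf_multc suminf_erlang_density[OF l_pos])
  also have "\<dots> = (\<integral>\<^sup>+s. (\<integral>\<^sup>+u. (ennreal l)\<^sup>2 * (g s * indicator {0..} s * (g (s + u) * indicator {0..} u)) \<partial>lborel) \<partial>lborel)"
    by (simp add: ac_simps power2_eq_square)
  also have "\<dots> = (ennreal l)\<^sup>2 * (\<integral>\<^sup>+s. (\<integral>\<^sup>+u. g s * indicator {0..} s * (g (s + u) * indicator {0..} u) \<partial>lborel) \<partial>lborel)"
    by (simp add: nn_integral_cmult)
  finally have "(\<Sum>k. \<Sum>k'. if k \<noteq> k' then \<integral>\<^sup>+\<omega>. g (\<Sum>j\<le>k. X j \<omega>) * g (\<Sum>j\<le>k'. X j \<omega>) \<partial>M else 0) =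
     (ennreal l)\<^sup>2 * (2 * (\<integral>\<^sup>+s. (\<integral>\<^sup>+u. g s * indicator {0..} s * (g (s + u) * indicator {0..} u) \<partial>lborel) \<partial>lborel))"
    by (subst suminf_offdiag_symmetric) (simp_all add: mult.commute mult.left_commute)
  then show ?thesis
    unfolding nn_integral_ordered_pairs[OF assms] by (simp add: power_mult_distrib)
qed

end


section \<open>The random inputs of a JIQ system\<close>

lemma pick_in:
  assumes "finite A" "A \<noteq> {}" "0 \<le> u" "u < 1"
  shows "pick A u \<in> A"
proof -
  have "u * real (card A) < real (card A)"
    using assms by (simp add: card_gt_0_iff)
  then have "nat \<lfloor>u * real (card A)\<rfloor> < card A"
    using assms(3) by (simp add: nat_less_iff floor_less_iff)
  then show ?thesis
    unfolding pick_def using assms(1) nth_mem[of _ "sorted_list_of_set A"] by simp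
qed

lemma jiq_policy_in_pool:
  assumes "finite (pool (z i k))" "pool (z i k) \<noteq> {}" "u i k \<in> {0..<1}"
  shows "jiq_policy pool z u (i, k) B \<in> pool (z i k)"
    and "\<not> pool (z i k) \<subseteq> B \<Longrightarrow> jiq_policy pool z u (i, k) B \<notin> B"
proof -
  let ?A = "if pool (z i k) - B \<noteq> {} then pool (z i k) - B else pool (z i k)"
  have "pick ?A (u i k) \<in> ?A"
    using assms by (intro pick_in) auto
  then show "jiq_policy pool z u (i, k) B \<in> pool (z i k)"
    and "\<not> pool (z i k) \<subseteq> B \<Longrightarrow> jiq_policy pool z u (i, k) B \<notin> B"
    by (auto simp: jiq_policy_def Let_def split: if_splits)
qed

context jiq_inputs
begin

abbreviation dispatchers :: "nat set" where
  "dispatchers \<equiv> {i \<in> {1..W}. 0 < lam i}"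

abbreviation tasks :: "task set" where
  "tasks \<equiv> valid_tasks W lam"

definition coord :: "input \<Rightarrow> 'a \<Rightarrow> real" where
  "coord c = (case c of
      Interarrival i k \<Rightarrow> X i k
    | Target i k \<Rightarrow> (\<lambda>\<omega>. real (Z i k \<omega>))
    | Selection i k \<Rightarrow> U i k
    | Service i k j \<Rightarrow> S i k j)"

definition coords :: "input set" where
  "coords = (\<Union>i\<in>dispatchers. \<Union>k.
     {Interarrival i k, Target i k, Selection i k} \<union> Service i k ` {j\<in>{1..N}. 0 < rate i j})"

sublocale indep_coords P coord coords
  using independent unfolding coord_def[abs_def] coords_def by unfold_locales

definition all_but_service :: "task set \<Rightarrow> input set" where
  "all_but_service A = {c \<in> coords. \<forall>i k j. c = Service i k j \<longrightarrow> (i, k) \<notin> A}"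

lemma all_but_service_subset: "all_but_service A \<subseteq> coords"
  by (auto simp: all_but_service_def)

lemma all_but_service_antimono: "A \<subseteq> B \<Longrightarrow> all_but_service B \<subseteq> all_but_service A"
  by (auto simp: all_but_service_def)

lemma valid_task_iff: "(i, k) \<in> tasks \<longleftrightarrow> i \<in> dispatchers"
  by (auto simp: valid_tasks_def)

lemma coords_intros:
  assumes "(i, k) \<in> tasks"
  shows "Interarrival i l \<in> all_but_service A" "Target i k \<in> all_but_service A" "Selection i k \<in> all_but_service A"
    and "j \<in> {1..N} \<Longrightarrow> 0 < rate i j \<Longrightarrow> (i, k) \<notin> A \<Longrightarrow> Service i k j \<in> all_but_service A"
    and "j \<in> {1..N} \<Longrightarrow> 0 < rate i j \<Longrightarrow> Service i k j \<in> coords"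
  using assms by (auto simp: valid_task_iff coords_def all_but_service_def)

abbreviation arr :: "'a \<Rightarrow> task \<Rightarrow> real" where
  "arr \<omega> \<equiv> arrival (\<lambda>i k. X i k \<omega>)"

abbreviation srv :: "'a \<Rightarrow> task \<Rightarrow> nat \<Rightarrow> ereal" where
  "srv \<omega> \<equiv> service_time N rate (\<lambda>i k j. S i k j \<omega>)"

abbreviation arriving :: "real \<Rightarrow> 'a \<Rightarrow> task list" where
  "arriving T \<omega> \<equiv> arriving_tasks W lam (\<lambda>i k. X i k \<omega>) T"

lemma measurable_X: "(i, k) \<in> tasks \<Longrightarrow> X i l \<in> borel_measurable (gen (all_but_service A))"
  using measurable_gen_coord[OF coords_intros(1)] by (simp add: coord_def)

lemma measurable_arr: "\<tau> \<in> tasks \<Longrightarrow> (\<lambda>\<omega>. arr \<omega> \<tau>) \<in> borel_measurable (gen (all_but_service A))"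
  by (cases \<tau>) (auto simp: arrival_def intro!: borel_measurable_sum measurable_X)

lemma measurable_Z:
  assumes "(i, k) \<in> tasks"
  shows "Z i k \<in> measurable (gen {Target i k}) (count_space UNIV)"
proof -
  have "(\<lambda>\<omega>. real (Z i k \<omega>)) \<in> borel_measurable (gen {Target i k})"
    using measurable_gen_coord[of "Target i k" "{Target i k}"] by (simp add: coord_def)
  then have "(\<lambda>\<omega>. \<lfloor>real (Z i k \<omega>)\<rfloor>) \<in> measurable (gen {Target i k}) (count_space UNIV)"
    by measurable
  from measurable_compose[OF this, of nat "count_space UNIV"] show ?thesis by simp
qed

lemma measurable_Z_all_but_service: "(i, k) \<in> tasks \<Longrightarrow> Z i k \<in> measurable (gen (all_but_service A)) (count_space UNIV)"
  by (rule measurable_gen_mono[OF measurable_Z]) (auto intro: coords_intros)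

lemma measurable_U: "(i, k) \<in> tasks \<Longrightarrow> U i k \<in> borel_measurable (gen (all_but_service A))"
  using measurable_gen_coord[OF coords_intros(3)] by (simp add: coord_def)

lemma measurable_srv:
  assumes "\<tau> \<in> tasks" "\<tau> \<notin> A"
  shows "(\<lambda>\<omega>. srv \<omega> \<tau> j) \<in> borel_measurable (gen (all_but_service A))"
proof (cases \<tau>)
  case (Pair i k)
  show ?thesis
  proof (cases "j \<in> {1..N} \<and> 0 < rate i j")
    case True
    then have "S i k j \<in> borel_measurable (gen (all_but_service A))"
      using measurable_gen_coord[OF coords_intros(4)[of i k j A]] assms Pair by (simp add: coord_def)
    then show ?thesis using True by (simp add: service_time_def Pair)
  next
    case False
    then have "srv \<omega> \<tau> j = \<infinity>" for \<omega>
      unfolding service_time_def Pair by (simp only: prod.case if_False)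
    then show ?thesis by simp
  qed
qed

lemma measurable_arriving:
  "arriving T \<in> measurable (gen (all_but_service A)) (count_space (lists tasks))"
  by (rule measurable_arriving_tasks) (rule measurable_arr)

end

locale jiq_pools = jiq_inputs P N W H M cls p lam rate X Z U S
  for P :: "'a measure" and N W H M cls p lam rate X Z U S +
  fixes pool :: "nat \<Rightarrow> nat set" and T :: real
  assumes pool_subset: "pool m \<subseteq> {1..N}"
begin

abbreviation policy :: "'a \<Rightarrow> task \<Rightarrow> nat set \<Rightarrow> nat" where
  "policy \<omega> \<equiv> jiq_policy pool (\<lambda>i k. Z i k \<omega>) (\<lambda>i k. U i k \<omega>)"

lemma finite_pool: "finite (pool m)"
  using pool_subset finite_subset by blast

lemma dynamics: "measurable_dynamics (gen (all_but_service A)) tasks (tasks - A) policy arr srv"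
proof
  fix \<tau> and B :: "'a \<Rightarrow> nat set"
  assume "\<tau> \<in> tasks" "\<And>j. Measurable.pred (gen (all_but_service A)) (\<lambda>\<omega>. j \<in> B \<omega>)"
  moreover have "pool m \<subseteq> {..N}" for m using pool_subset[of m] by auto
  ultimately show "(\<lambda>\<omega>. policy \<omega> \<tau> (B \<omega>)) \<in> measurable (gen (all_but_service A)) (count_space UNIV)"
    by (cases \<tau>) (auto intro!: measurable_jiq_policy[where n=N] measurable_Z_all_but_service measurable_U)
qed (auto intro: measurable_arr measurable_srv)

lemma sets_jiq_busy_event: "jiq_busy_event P N W pool lam rate X Z U S T \<in> sets P"
proof -
  interpret measurable_dynamics "gen (all_but_service {})" tasks "tasks - {}" policy arr srv
    by (rule dynamics)
  have "Measurable.pred (gen (all_but_service {})) (\<lambda>\<omega>. assigned_to_busy (policy \<omega>) (arr \<omega>) (srv \<omega>) [] (arriving T \<omega>))"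
    by (rule pred_assigned_to_busy) (simp add: measurable_arriving)
  from measurable_gen_imp[OF this all_but_service_subset] show ?thesis
    by (simp add: jiq_busy_event_def pred_def Let_def)
qed

definition chosen_after :: "'a \<Rightarrow> task list \<Rightarrow> task \<Rightarrow> nat" where
  "chosen_after \<omega> L \<tau> = chosen_server (policy \<omega>) (arr \<omega>) (history_after (policy \<omega>) (arr \<omega>) (srv \<omega>) L) \<tau>"

definition before :: "'a \<Rightarrow> task \<Rightarrow> task list" where
  "before \<omega> \<tau> = takeWhile (\<lambda>\<tau>'. \<tau>' \<noteq> \<tau>) (arriving T \<omega>)"

definition chosen :: "'a \<Rightarrow> task \<Rightarrow> nat" where
  "chosen \<omega> \<tau> = chosen_after \<omega> (before \<omega> \<tau>) \<tau>"

text \<open>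
  The tasks that are present at some time in \<open>[t, e]\<close> if service starts upon arrival; this agrees with
  the true dynamics until the first task is assigned to a busy server.\<close>

definition alive :: "nat \<Rightarrow> real \<Rightarrow> real \<Rightarrow> task \<Rightarrow> 'a set" where
  "alive m t e \<tau> = {\<omega> \<in> space P. Z (fst \<tau>) (snd \<tau>) \<omega> = m \<and> arr \<omega> \<tau> \<le> e \<and>
     ereal (t - arr \<omega> \<tau>) < srv \<omega> \<tau> (chosen \<omega> \<tau>)}"

definition alive_count :: "nat \<Rightarrow> real \<Rightarrow> real \<Rightarrow> 'a \<Rightarrow> ennreal" where
  "alive_count m t e \<omega> = (\<Sum>i\<in>dispatchers. \<Sum>k. indicator (alive m t e (i, k)) \<omega>)"

lemma before_dichotomy: "\<tau> \<notin> set (before \<omega> \<tau>') \<or> \<tau>' \<notin> set (before \<omega> \<tau>)"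
proof -
  have "\<tau> \<notin> set (takeWhile (\<lambda>\<sigma>. \<sigma> \<noteq> \<tau>') l) \<or> \<tau>' \<notin> set (takeWhile (\<lambda>\<sigma>. \<sigma> \<noteq> \<tau>) l)" for l :: "task list"
    by (induction l) auto
  then show ?thesis by (simp add: before_def)
qed

lemma measurable_before:
  "(\<lambda>\<omega>. before \<omega> \<tau>) \<in> measurable (gen (all_but_service A)) (count_space (lists (tasks - {\<tau>})))"
  unfolding before_def
  by (rule measurable_compose[OF measurable_arriving]) (auto dest: set_takeWhileD)

lemma measurable_chosen_after:
  assumes "L \<in> measurable (gen (all_but_service A)) (count_space (lists (tasks - A)))" "\<tau> \<in> tasks"
  shows "(\<lambda>\<omega>. chosen_after \<omega> (L \<omega>) \<tau>) \<in> measurable (gen (all_but_service A)) (count_space UNIV)"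
proof -
  interpret measurable_dynamics "gen (all_but_service A)" tasks "tasks - A" policy arr srv
    by (rule dynamics)
  show ?thesis unfolding chosen_after_def by (rule measurable_chosen_server_after[OF assms])
qed

lemma measurable_chosen:
  "\<tau> \<in> tasks \<Longrightarrow> (\<lambda>\<omega>. chosen \<omega> \<tau>) \<in> measurable (gen (all_but_service {\<tau>})) (count_space UNIV)"
  unfolding chosen_def by (rule measurable_chosen_after[OF measurable_before])

lemma AE_U:
  assumes "(i, k) \<in> tasks"
  shows "AE \<omega> in P. U i k \<omega> \<in> {0..<1}"
proof -
  have [measurable]: "U i k \<in> borel_measurable P"
    using assms by (blast intro: measurable_gen_imp[OF measurable_U all_but_service_subset])
  have "AE x in uniform_measure lborel {0..1}. x \<in> {0..<1::real}"
    using AE_lborel_singleton[of "1::real"] by (auto simp: AE_uniform_measure elim!: eventually_mono)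
  then have "AE x in distr P borel (U i k). x \<in> {0..<1::real}"
    using assms by (subst selection) (auto simp: valid_task_iff)
  then show ?thesis by (simp add: AE_distr_iff)
qed

lemma chosen_after_in_pool:
  assumes "U i k \<omega> \<in> {0..<1}" "pool (Z i k \<omega>) \<noteq> {}"
  shows "chosen_after \<omega> L (i, k) \<in> pool (Z i k \<omega>)"
  using jiq_policy_in_pool(1)[of pool "\<lambda>i k. Z i k \<omega>" i k "\<lambda>i k. U i k \<omega>"] assms finite_pool
  by (simp add: chosen_after_def chosen_server_def)

end

locale jiq_target = jiq_pools P N W H M cls p lam rate X Z U S pool T
  for P :: "'a measure" and N W H M cls p lam rate X Z U S pool T +
  fixes m :: nat and \<rho> q :: "nat \<Rightarrow> real"
  assumes pool_nonempty: "pool m \<noteq> {}"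
    and rate_eq: "\<And>i j. i \<in> {1..W} \<Longrightarrow> 0 < lam i \<Longrightarrow> j \<in> pool m \<Longrightarrow> rate i j = \<rho> i"
    and \<rho>_nonneg: "\<And>i. i \<in> {1..W} \<Longrightarrow> 0 < lam i \<Longrightarrow> 0 \<le> \<rho> i"
    and q_nonneg: "\<And>i. i \<in> {1..W} \<Longrightarrow> 0 < lam i \<Longrightarrow> 0 \<le> q i"
    and prob_target: "\<And>i k. i \<in> {1..W} \<Longrightarrow> 0 < lam i \<Longrightarrow> \<P>(\<omega> in P. Z i k \<omega> = m) = q i"
begin

definition survival :: "nat \<Rightarrow> real \<Rightarrow> ennreal" where
  "survival i c = ennreal (min 1 (exp (- \<rho> i * c)))"

lemma borel_measurable_survival [measurable]: "survival i \<in> borel_measurable borel"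
  unfolding survival_def[abs_def] by measurable

lemma emeasure_srv:
  assumes "i \<in> dispatchers" "j \<in> pool m" "0 < \<rho> i"
  shows "emeasure P {\<omega> \<in> space P. c < S i k j \<omega>} = survival i c"
proof -
  have D: "distributed P lborel (S i k j) (exponential_density (\<rho> i))"
    using assms pool_subset[of m] service[of i j k] rate_eq[of i j] by auto
  show ?thesis
  proof (cases "0 \<le> c")
    case True
    then have "exp (- \<rho> i * c) \<le> 1" using assms by simp
    with exponential_distributedD_gt[OF D True] assms(3) show ?thesis
      by (simp add: survival_def emeasure_eq_measure min_def mult.commute)
  next
    case False
    have "1 = \<P>(\<omega> in P. 0 < S i k j \<omega>)"
      using exponential_distributedD_gt[OF D, of 0] assms(3) by simp
    also have "\<dots> \<le> \<P>(\<omega> in P. c < S i k j \<omega>)"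
      using False distributed_measurable[OF D] by (intro finite_measure_mono) auto
    finally have "\<P>(\<omega> in P. c < S i k j \<omega>) = 1" by (simp add: antisym)
    moreover have "1 \<le> exp (- \<rho> i * c)"
      using False assms(3) by (simp add: mult_nonneg_nonpos)
    ultimately show ?thesis by (simp add: survival_def emeasure_eq_measure)
  qed
qed

text \<open>
  Whichever server of the pool a task is sent to, its service time is exponential and independent of
  everything that the choice depends on.\<close>

lemma nn_integral_service:
  assumes \<tau>: "(i, k) \<in> tasks" "(i, k) \<in> A"
    and [measurable]: "F \<in> borel_measurable (gen (all_but_service A))" "c \<in> borel_measurable (gen (all_but_service A))"
      "J \<in> measurable (gen (all_but_service A)) (count_space UNIV)"
    and J: "AE \<omega> in P. F \<omega> \<noteq> 0 \<longrightarrow> J \<omega> \<in> pool m"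
  shows "(\<integral>\<^sup>+\<omega>. F \<omega> * indicator {\<omega>. ereal (c \<omega>) < srv \<omega> (i, k) (J \<omega>)} \<omega> \<partial>P) =
    (\<integral>\<^sup>+\<omega>. F \<omega> * survival i (c \<omega>) \<partial>P)"
proof -
  have i: "i \<in> dispatchers" using \<tau> by (simp add: valid_task_iff)
  have [measurable]: "F \<in> borel_measurable P" "c \<in> borel_measurable P" "J \<in> measurable P (count_space UNIV)"
    by (rule measurable_gen_imp[OF _ all_but_service_subset[of A]], fact)+
  have [measurable]: "(\<lambda>\<omega>. srv \<omega> (i, k) j) \<in> borel_measurable P" for j
    using measurable_gen_imp[OF measurable_srv[of _ "{}"] all_but_service_subset] \<tau> by simp
  let ?F = "\<lambda>j \<omega>. F \<omega> * indicator {\<omega>. J \<omega> = j} \<omega>"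
  have split: "(\<Sum>j\<in>pool m. ?F j \<omega> * G j) = F \<omega> * G (J \<omega>)" if "F \<omega> \<noteq> 0 \<longrightarrow> J \<omega> \<in> pool m"
    for \<omega> and G :: "nat \<Rightarrow> ennreal"
  proof (cases "F \<omega> = 0")
    case False
    then have "(\<Sum>j\<in>pool m. ?F j \<omega> * G j) = (\<Sum>j\<in>pool m. if j = J \<omega> then F \<omega> * G j else 0)"
      by (intro sum.cong) auto
    then show ?thesis using that False by (simp add: finite_pool)
  qed simp
  have step: "(\<integral>\<^sup>+\<omega>. ?F j \<omega> * indicator {\<omega>. ereal (c \<omega>) < srv \<omega> (i, k) j} \<omega> \<partial>P) =
      (\<integral>\<^sup>+\<omega>. ?F j \<omega> * survival i (c \<omega>) \<partial>P)" if j: "j \<in> pool m" for j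
  proof (cases "0 < \<rho> i")
    case True
    then have Sj: "Service i k j \<in> coords" "srv \<omega> (i, k) j = ereal (S i k j \<omega>)" for \<omega>
      using j i \<tau> pool_subset[of m] rate_eq[of i j] by (auto intro!: coords_intros simp: service_time_def)
    have "(\<integral>\<^sup>+\<omega>. ?F j \<omega> * indicator {\<omega>. c \<omega> < coord (Service i k j) \<omega>} \<omega> \<partial>P) =
        (\<integral>\<^sup>+\<omega>. ?F j \<omega> * emeasure P {\<omega>' \<in> space P. c \<omega> < coord (Service i k j) \<omega>'} \<partial>P)"
      by (rule nn_integral_tail_indep[OF _ _ all_but_service_subset[of A] Sj(1)])
        (measurable, use \<tau> in \<open>auto simp: all_but_service_def\<close>)
    then show ?thesis using Sj(2) emeasure_srv[OF i j True] by (simp add: coord_def)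
  next
    case False
    then have "\<rho> i = 0" using \<rho>_nonneg[of i] i by simp
    then show ?thesis
      using i j rate_eq[of i j] by (simp add: survival_def service_time_def)
  qed
  have "(\<integral>\<^sup>+\<omega>. F \<omega> * indicator {\<omega>. ereal (c \<omega>) < srv \<omega> (i, k) (J \<omega>)} \<omega> \<partial>P) =
      (\<integral>\<^sup>+\<omega>. (\<Sum>j\<in>pool m. ?F j \<omega> * indicator {\<omega>. ereal (c \<omega>) < srv \<omega> (i, k) j} \<omega>) \<partial>P)"
  proof (rule nn_integral_cong_AE, use J in eventually_elim)
    case (elim \<omega>)
    show ?case
      using split[OF elim, of "\<lambda>j. indicator {\<omega>. ereal (c \<omega>) < srv \<omega> (i, k) j} \<omega>"]
      by (simp add: indicator_def)
  qed
  also have "\<dots> = (\<Sum>j\<in>pool m. \<integral>\<^sup>+\<omega>. ?F j \<omega> * indicator {\<omega>. ereal (c \<omega>) < srv \<omega> (i, k) j} \<omega> \<partial>P)"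
    by (rule nn_integral_sum) measurable
  also have "\<dots> = (\<Sum>j\<in>pool m. \<integral>\<^sup>+\<omega>. ?F j \<omega> * survival i (c \<omega>) \<partial>P)"
    by (intro sum.cong step) auto
  also have "\<dots> = (\<integral>\<^sup>+\<omega>. (\<Sum>j\<in>pool m. ?F j \<omega> * survival i (c \<omega>)) \<partial>P)"
    by (rule nn_integral_sum[symmetric]) measurable
  also have "\<dots> = (\<integral>\<^sup>+\<omega>. F \<omega> * survival i (c \<omega>) \<partial>P)"
    using J by (intro nn_integral_cong_AE) (auto elim!: eventually_mono simp: split)
  finally show ?thesis .
qed

end


section \<open>Tasks present in a time window\<close>

context jiq_target
begin

definition target_hit :: "task \<Rightarrow> 'a \<Rightarrow> ennreal" where
  "target_hit \<tau> \<omega> = indicator {m} (Z (fst \<tau>) (snd \<tau>) \<omega>)"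

definition presence :: "real \<Rightarrow> real \<Rightarrow> nat \<Rightarrow> real \<Rightarrow> ennreal" where
  "presence t e i x = indicator {..e} x * survival i (t - x)"

lemma borel_measurable_presence [measurable]: "presence t e i \<in> borel_measurable borel"
  unfolding presence_def[abs_def] by measurable

lemma measurable_target_hit: "\<tau> \<in> tasks \<Longrightarrow> target_hit \<tau> \<in> borel_measurable (gen (all_but_service A))"
  using measurable_compose[OF measurable_Z_all_but_service[of "fst \<tau>" "snd \<tau>" A], of "indicator {m}" borel]
  by (simp add: target_hit_def[abs_def])

lemma measurable_target_hit_single:
  "\<tau> \<in> tasks \<Longrightarrow> target_hit \<tau> \<in> borel_measurable (gen {Target (fst \<tau>) (snd \<tau>)})"
  using measurable_compose[OF measurable_Z[of "fst \<tau>" "snd \<tau>"], of "indicator {m}" borel]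
  by (simp add: target_hit_def[abs_def])

lemma nn_integral_target_hit:
  assumes "\<tau> \<in> tasks"
  shows "(\<integral>\<^sup>+\<omega>. target_hit \<tau> \<omega> \<partial>P) = ennreal (q (fst \<tau>))"
proof -
  have "Z (fst \<tau>) (snd \<tau>) \<in> measurable P (count_space UNIV)"
    by (rule measurable_gen_imp[OF measurable_Z_all_but_service all_but_service_subset]) (use assms in simp)
  then have [measurable]: "{\<omega> \<in> space P. Z (fst \<tau>) (snd \<tau>) \<omega> = m} \<in> sets P" by simp
  have "(\<integral>\<^sup>+\<omega>. target_hit \<tau> \<omega> \<partial>P) = (\<integral>\<^sup>+\<omega>. indicator {\<omega> \<in> space P. Z (fst \<tau>) (snd \<tau>) \<omega> = m} \<omega> \<partial>P)"
    by (intro nn_integral_cong) (auto simp: target_hit_def split: split_indicator)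
  also have "\<dots> = emeasure P {\<omega> \<in> space P. Z (fst \<tau>) (snd \<tau>) \<omega> = m}"
    by (rule nn_integral_indicator) measurable
  also have "\<dots> = ennreal (q (fst \<tau>))"
    using prob_target[of "fst \<tau>" "snd \<tau>"] assms by (cases \<tau>) (simp add: emeasure_eq_measure valid_task_iff)
  finally show ?thesis .
qed

definition interarrivals :: "input set" where
  "interarrivals = (\<Union>i\<in>dispatchers. range (Interarrival i))"

lemma interarrivals_subset: "interarrivals \<subseteq> coords"
  and Target_notin_interarrivals: "Target i k \<notin> interarrivals"
  by (auto simp: interarrivals_def coords_def)

lemma Target_in_coords: "\<tau> \<in> tasks \<Longrightarrow> Target (fst \<tau>) (snd \<tau>) \<in> coords"
  using coords_intros(2)[of "fst \<tau>" "snd \<tau>" "{}"] all_but_service_subset by auto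

lemma measurable_arr_interarrivals:
  assumes "\<tau> \<in> tasks"
  shows "(\<lambda>\<omega>. arr \<omega> \<tau>) \<in> borel_measurable (gen interarrivals)"
proof -
  have "coord (Interarrival (fst \<tau>) l) \<in> borel_measurable (gen interarrivals)" for l
    using assms by (intro measurable_gen_coord) (auto simp: valid_tasks_def interarrivals_def)
  then show ?thesis
    by (auto simp: arrival_def coord_def case_prod_beta intro!: borel_measurable_sum)
qed

lemma nn_integral_target_hit_mult:
  assumes "\<tau> \<in> tasks" "F \<in> borel_measurable (gen K)" "K \<subseteq> coords" "Target (fst \<tau>) (snd \<tau>) \<notin> K"
  shows "(\<integral>\<^sup>+\<omega>. target_hit \<tau> \<omega> * F \<omega> \<partial>P) = ennreal (q (fst \<tau>)) * (\<integral>\<^sup>+\<omega>. F \<omega> \<partial>P)"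
  using nn_integral_mult_indep[OF measurable_target_hit_single[OF assms(1)] assms(2) _ assms(3)]
    Target_in_coords[OF assms(1)] assms(4) nn_integral_target_hit[OF assms(1)] by simp

lemma AE_chosen_after_in_pool:
  assumes "\<tau> \<in> tasks"
  shows "AE \<omega> in P. target_hit \<tau> \<omega> \<noteq> 0 \<longrightarrow> (\<forall>L. chosen_after \<omega> L \<tau> \<in> pool m)"
proof -
  obtain i k where \<tau>: "\<tau> = (i, k)" by (cases \<tau>)
  have "AE \<omega> in P. U i k \<omega> \<in> {0..<1}" using assms by (intro AE_U) (simp add: \<tau>)
  then show ?thesis
  proof eventually_elim
    case (elim \<omega>)
    show ?case
      using chosen_after_in_pool[OF elim] pool_nonempty
      by (cases "Z i k \<omega> = m") (simp_all add: target_hit_def \<tau>)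
  qed
qed

lemma indicator_alive:
  "\<omega> \<in> space P \<Longrightarrow> indicator (alive m t e \<tau>) \<omega> = target_hit \<tau> \<omega> * indicator {..e} (arr \<omega> \<tau>) *
     (indicator {\<omega>. ereal (t - arr \<omega> \<tau>) < srv \<omega> \<tau> (chosen \<omega> \<tau>)} \<omega> :: ennreal)"
  by (auto simp: alive_def target_hit_def split: split_indicator)

lemma measurable_indicator_service:
  assumes "J \<in> measurable (gen (all_but_service A)) (count_space UNIV)" "\<tau> \<in> tasks" "\<tau> \<notin> A"
  shows "indicator {\<omega>. ereal (t - arr \<omega> \<tau>) < srv \<omega> \<tau> (J \<omega>)} \<in> borel_measurable (gen (all_but_service A))"
proof -
  have [measurable]: "(\<lambda>\<omega>. arr \<omega> \<tau>) \<in> borel_measurable (gen (all_but_service A))"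
    by (rule measurable_arr) fact
  have [measurable]: "(\<lambda>\<omega>. srv \<omega> \<tau> (J \<omega>)) \<in> borel_measurable (gen (all_but_service A))"
    by (rule measurable_compose_countable[where f="\<lambda>j \<omega>. srv \<omega> \<tau> j", OF _ assms(1)])
      (rule measurable_srv[OF assms(2,3)])
  show ?thesis by measurable
qed

lemma measurable_alive:
  assumes "\<tau> \<in> tasks"
  shows "alive m t e \<tau> \<in> sets P"
proof -
  have "(\<lambda>\<omega>. chosen \<omega> \<tau>) \<in> measurable (gen (all_but_service {})) (count_space UNIV)"
    using measurable_chosen[OF assms] all_but_service_antimono[of "{}"] by (blast intro: measurable_gen_mono)
  then have [measurable]: "indicator {\<omega>. ereal (t - arr \<omega> \<tau>) < srv \<omega> \<tau> (chosen \<omega> \<tau>)} \<in> borel_measurable (gen (all_but_service {}))"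
    using assms by (rule measurable_indicator_service) simp
  have [measurable]: "(\<lambda>\<omega>. arr \<omega> \<tau>) \<in> borel_measurable (gen (all_but_service {}))"
    "target_hit \<tau> \<in> borel_measurable (gen (all_but_service {}))"
    using assms by (auto intro: measurable_arr measurable_target_hit)
  have "(\<lambda>\<omega>. target_hit \<tau> \<omega> * indicator {..e} (arr \<omega> \<tau>) *
     (indicator {\<omega>. ereal (t - arr \<omega> \<tau>) < srv \<omega> \<tau> (chosen \<omega> \<tau>)} \<omega> :: ennreal)) \<in> borel_measurable (gen (all_but_service {}))"
    by measurable
  then have "(\<lambda>\<omega>. indicator (alive m t e \<tau>) \<omega> :: ennreal) \<in> borel_measurable (gen (all_but_service {}))"
    by (subst measurable_cong[OF indicator_alive]) simp_all
  then have "indicator (alive m t e \<tau>) \<in> (borel_measurable P :: ('a \<Rightarrow> ennreal) set)"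
    by (rule measurable_gen_imp[OF _ all_but_service_subset])
  then have "alive m t e \<tau> \<inter> space P \<in> sets P"
    by (simp add: borel_measurable_indicator_iff)
  moreover have "alive m t e \<tau> \<inter> space P = alive m t e \<tau>" by (auto simp: alive_def)
  ultimately show ?thesis by simp
qed

lemma nn_integral_alive:
  assumes "\<tau> \<in> tasks"
  shows "(\<integral>\<^sup>+\<omega>. indicator (alive m t e \<tau>) \<omega> \<partial>P) =
    ennreal (q (fst \<tau>)) * (\<integral>\<^sup>+\<omega>. presence t e (fst \<tau>) (arr \<omega> \<tau>) \<partial>P)"
proof -
  obtain i k where \<tau>: "\<tau> = (i, k)" by (cases \<tau>)
  have [measurable]: "(\<lambda>\<omega>. arr \<omega> \<tau>) \<in> borel_measurable (gen (all_but_service {\<tau>}))"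
    "target_hit \<tau> \<in> borel_measurable (gen (all_but_service {\<tau>}))"
    using assms by (auto intro: measurable_arr measurable_target_hit)
  have "(\<integral>\<^sup>+\<omega>. indicator (alive m t e \<tau>) \<omega> \<partial>P) = (\<integral>\<^sup>+\<omega>. target_hit \<tau> \<omega> * indicator {..e} (arr \<omega> \<tau>) *
     indicator {\<omega>. ereal (t - arr \<omega> \<tau>) < srv \<omega> \<tau> (chosen \<omega> \<tau>)} \<omega> \<partial>P)"
    by (intro nn_integral_cong) (simp add: indicator_alive)
  also have "\<dots> = (\<integral>\<^sup>+\<omega>. target_hit \<tau> \<omega> * indicator {..e} (arr \<omega> \<tau>) * survival i (t - arr \<omega> \<tau>) \<partial>P)"
    unfolding \<tau>
  proof (rule nn_integral_service[where A="{\<tau>}"])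
    show "AE \<omega> in P. target_hit (i, k) \<omega> * indicator {..e} (arr \<omega> (i, k)) \<noteq> 0 \<longrightarrow> chosen \<omega> (i, k) \<in> pool m"
      using AE_chosen_after_in_pool[OF assms] by (auto elim!: eventually_mono simp: \<tau> chosen_def)
  qed (use assms in \<open>simp_all add: \<tau>[symmetric] measurable_chosen\<close>)
  also have "\<dots> = (\<integral>\<^sup>+\<omega>. target_hit \<tau> \<omega> * presence t e i (arr \<omega> \<tau>) \<partial>P)"
    by (simp add: presence_def mult.assoc)
  also have "\<dots> = ennreal (q i) * (\<integral>\<^sup>+\<omega>. presence t e i (arr \<omega> \<tau>) \<partial>P)"
    using nn_integral_target_hit_mult[OF assms _ interarrivals_subset Target_notin_interarrivals]
      measurable_arr_interarrivals[OF assms] by (simp add: \<tau>)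
  finally show ?thesis by (simp add: \<tau>)
qed

text \<open>
  The service time of the task that comes second is integrated out first: the assignment of the
  other task does not depend on it.\<close>

lemma nn_integral_alive_ordered:
  assumes \<tau>: "\<tau> \<in> tasks" "\<tau>' \<in> tasks" "\<tau> \<noteq> \<tau>'"
    and Q: "Q \<in> borel_measurable (gen (all_but_service {\<tau>, \<tau>'}))"
    and ordered: "\<And>\<omega>. Q \<omega> \<noteq> 0 \<Longrightarrow> \<tau>' \<notin> set (before \<omega> \<tau>)"
  shows "(\<integral>\<^sup>+\<omega>. Q \<omega> * indicator (alive m t e \<tau>) \<omega> * indicator (alive m t e \<tau>') \<omega> \<partial>P) =
    (\<integral>\<^sup>+\<omega>. Q \<omega> * (target_hit \<tau> \<omega> * presence t e (fst \<tau>) (arr \<omega> \<tau>)) *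
      (target_hit \<tau>' \<omega> * presence t e (fst \<tau>') (arr \<omega> \<tau>')) \<partial>P)"
proof -
  obtain i k i' k' where ik: "\<tau> = (i, k)" "\<tau>' = (i', k')" by (cases \<tau>; cases \<tau>')
  define L where "L \<omega> = (if \<tau>' \<in> set (before \<omega> \<tau>) then [] else before \<omega> \<tau>)" for \<omega>
  define J where "J \<omega> = chosen_after \<omega> (L \<omega>) \<tau>" for \<omega>
  have J_eq: "Q \<omega> \<noteq> 0 \<Longrightarrow> chosen \<omega> \<tau> = J \<omega>" for \<omega>
    using ordered by (simp add: J_def L_def chosen_def)
  have "L \<in> measurable (gen (all_but_service {\<tau>, \<tau>'})) (count_space (lists (tasks - {\<tau>, \<tau>'})))"
    unfolding L_def
    by (rule measurable_compose[OF measurable_before]) (auto split: if_splits)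
  then have J [measurable]: "J \<in> measurable (gen (all_but_service {\<tau>, \<tau>'})) (count_space UNIV)"
    unfolding J_def using \<tau>(1) by (rule measurable_chosen_after)
  have mono: "all_but_service {\<tau>, \<tau>'} \<subseteq> all_but_service {\<tau>'}" by (rule all_but_service_antimono) simp
  have [measurable]: "Q \<in> borel_measurable (gen (all_but_service {\<tau>'}))" "J \<in> measurable (gen (all_but_service {\<tau>'})) (count_space UNIV)"
    by (rule measurable_gen_mono[OF _ mono], fact)+
  note [measurable] = Q
  have [measurable]: "(\<lambda>\<omega>. arr \<omega> \<tau>) \<in> borel_measurable (gen (all_but_service A))"
    "(\<lambda>\<omega>. arr \<omega> \<tau>') \<in> borel_measurable (gen (all_but_service A))"
    "target_hit \<tau> \<in> borel_measurable (gen (all_but_service A))" "target_hit \<tau>' \<in> borel_measurable (gen (all_but_service A))" for A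
    using \<tau> by (auto intro: measurable_arr measurable_target_hit)
  have [measurable]: "indicator {\<omega>. ereal (t - arr \<omega> \<tau>) < srv \<omega> \<tau> (J \<omega>)} \<in> borel_measurable (gen (all_but_service {\<tau>'}))"
    by (rule measurable_indicator_service) (use \<tau> in \<open>simp_all\<close>)
  let ?s = "\<lambda>\<tau> \<omega>. target_hit \<tau> \<omega> * indicator {..e} (arr \<omega> \<tau>)"
  let ?F = "\<lambda>\<omega>. Q \<omega> * ?s \<tau> \<omega> * indicator {\<omega>. ereal (t - arr \<omega> \<tau>) < srv \<omega> \<tau> (J \<omega>)} \<omega> * ?s \<tau>' \<omega>"
  let ?G = "\<lambda>\<omega>. Q \<omega> * ?s \<tau> \<omega> * ?s \<tau>' \<omega> * survival i' (t - arr \<omega> \<tau>')"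
  have "(\<integral>\<^sup>+\<omega>. Q \<omega> * indicator (alive m t e \<tau>) \<omega> * indicator (alive m t e \<tau>') \<omega> \<partial>P) =
     (\<integral>\<^sup>+\<omega>. ?F \<omega> * indicator {\<omega>. ereal (t - arr \<omega> \<tau>') < srv \<omega> \<tau>' (chosen \<omega> \<tau>')} \<omega> \<partial>P)"
  proof (rule nn_integral_cong)
    fix \<omega> assume \<omega>: "\<omega> \<in> space P"
    have "indicator {\<omega>. ereal (t - arr \<omega> \<tau>) < srv \<omega> \<tau> (chosen \<omega> \<tau>)} \<omega> =
      (indicator {\<omega>. ereal (t - arr \<omega> \<tau>) < srv \<omega> \<tau> (J \<omega>)} \<omega> :: ennreal)" if "Q \<omega> \<noteq> 0"
      using J_eq[OF that] by (simp add: indicator_def)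
    then show "Q \<omega> * indicator (alive m t e \<tau>) \<omega> * indicator (alive m t e \<tau>') \<omega> =
      ?F \<omega> * indicator {\<omega>. ereal (t - arr \<omega> \<tau>') < srv \<omega> \<tau>' (chosen \<omega> \<tau>')} \<omega>"
      unfolding indicator_alive[OF \<omega>] by (cases "Q \<omega> = 0") (simp_all add: mult.assoc)
  qed
  also have "\<dots> = (\<integral>\<^sup>+\<omega>. ?F \<omega> * survival i' (t - arr \<omega> \<tau>') \<partial>P)"
    unfolding ik(2)
  proof (rule nn_integral_service[where A="{\<tau>'}"])
    show "AE \<omega> in P. Q \<omega> * ?s \<tau> \<omega> * indicator {\<omega>. ereal (t - arr \<omega> \<tau>) < srv \<omega> \<tau> (J \<omega>)} \<omega> * ?s (i', k') \<omega> \<noteq> 0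
        \<longrightarrow> chosen \<omega> (i', k') \<in> pool m"
      using AE_chosen_after_in_pool[OF \<tau>(2)] by (auto elim!: eventually_mono simp: ik(2) chosen_def)
  qed (use \<tau> in \<open>simp_all add: ik(2)[symmetric] measurable_chosen\<close>)
  also have "\<dots> = (\<integral>\<^sup>+\<omega>. ?G \<omega> * indicator {\<omega>. ereal (t - arr \<omega> \<tau>) < srv \<omega> \<tau> (J \<omega>)} \<omega> \<partial>P)"
    by (simp add: ac_simps)
  also have "\<dots> = (\<integral>\<^sup>+\<omega>. ?G \<omega> * survival i (t - arr \<omega> \<tau>) \<partial>P)"
    unfolding ik(1)
  proof (rule nn_integral_service[where A="{\<tau>, \<tau>'}"])
    show "AE \<omega> in P. Q \<omega> * ?s (i, k) \<omega> * ?s \<tau>' \<omega> * survival i' (t - arr \<omega> \<tau>') \<noteq> 0 \<longrightarrow> J \<omega> \<in> pool m"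
      using AE_chosen_after_in_pool[OF \<tau>(1)] by (auto elim!: eventually_mono simp: ik(1) J_def)
  qed (use \<tau> in \<open>simp_all add: ik(1)[symmetric]\<close>)
  also have "\<dots> = (\<integral>\<^sup>+\<omega>. Q \<omega> * (target_hit \<tau> \<omega> * presence t e (fst \<tau>) (arr \<omega> \<tau>)) *
      (target_hit \<tau>' \<omega> * presence t e (fst \<tau>') (arr \<omega> \<tau>')) \<partial>P)"
    by (simp add: presence_def ik ac_simps)
  finally show ?thesis .
qed

lemma nn_integral_alive_pair:
  assumes \<tau>: "\<tau> \<in> tasks" "\<tau>' \<in> tasks" "\<tau> \<noteq> \<tau>'"
  shows "(\<integral>\<^sup>+\<omega>. indicator (alive m t e \<tau>) \<omega> * indicator (alive m t e \<tau>') \<omega> \<partial>P) =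
    ennreal (q (fst \<tau>)) * ennreal (q (fst \<tau>')) *
      (\<integral>\<^sup>+\<omega>. presence t e (fst \<tau>) (arr \<omega> \<tau>) * presence t e (fst \<tau>') (arr \<omega> \<tau>') \<partial>P)"
proof -
  let ?Q = "indicator {\<omega>. \<tau>' \<notin> set (before \<omega> \<tau>)} :: 'a \<Rightarrow> ennreal"
  let ?R = "indicator {\<omega>. \<tau>' \<in> set (before \<omega> \<tau>)} :: 'a \<Rightarrow> ennreal"
  let ?h = "\<lambda>\<tau> \<omega>. target_hit \<tau> \<omega> * presence t e (fst \<tau>) (arr \<omega> \<tau>)"
  have Q: "?Q \<in> borel_measurable (gen (all_but_service A))" "?R \<in> borel_measurable (gen (all_but_service A))" for A
  proof -
    have "Measurable.pred (gen (all_but_service A)) (\<lambda>\<omega>. \<tau>' \<in> set (before \<omega> \<tau>))"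
      by (rule measurable_compose[OF measurable_before]) simp
    then show "?Q \<in> borel_measurable (gen (all_but_service A))" "?R \<in> borel_measurable (gen (all_but_service A))"
      by (auto intro!: borel_measurable_indicator')
  qed
  have QP [measurable]: "?Q \<in> borel_measurable P" "?R \<in> borel_measurable P"
    by (rule measurable_gen_imp[OF Q(1) all_but_service_subset[of "{}"]], rule measurable_gen_imp[OF Q(2) all_but_service_subset[of "{}"]])
  have hit [measurable]: "target_hit \<tau> \<in> borel_measurable P" "target_hit \<tau>' \<in> borel_measurable P"
    "(\<lambda>\<omega>. arr \<omega> \<tau>) \<in> borel_measurable P" "(\<lambda>\<omega>. arr \<omega> \<tau>') \<in> borel_measurable P"
    using \<tau> by (blast intro: measurable_gen_imp[OF measurable_target_hit all_but_service_subset]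
        measurable_gen_imp[OF measurable_arr all_but_service_subset])+
  have [measurable]: "alive m t e \<tau> \<in> sets P" "alive m t e \<tau>' \<in> sets P"
    using \<tau> by (auto intro: measurable_alive)
  have QR: "?Q \<omega> + ?R \<omega> = 1" for \<omega> by (simp split: split_indicator)
  have "(\<integral>\<^sup>+\<omega>. indicator (alive m t e \<tau>) \<omega> * indicator (alive m t e \<tau>') \<omega> \<partial>P) =
    (\<integral>\<^sup>+\<omega>. ?Q \<omega> * indicator (alive m t e \<tau>) \<omega> * indicator (alive m t e \<tau>') \<omega> +
      ?R \<omega> * indicator (alive m t e \<tau>') \<omega> * indicator (alive m t e \<tau>) \<omega> \<partial>P)"
    by (intro nn_integral_cong) (auto split: split_indicator)
  also have "\<dots> = (\<integral>\<^sup>+\<omega>. ?Q \<omega> * indicator (alive m t e \<tau>) \<omega> * indicator (alive m t e \<tau>') \<omega> \<partial>P) +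
      (\<integral>\<^sup>+\<omega>. ?R \<omega> * indicator (alive m t e \<tau>') \<omega> * indicator (alive m t e \<tau>) \<omega> \<partial>P)"
    by (rule nn_integral_add) measurable
  also have "\<dots> = (\<integral>\<^sup>+\<omega>. ?Q \<omega> * ?h \<tau> \<omega> * ?h \<tau>' \<omega> \<partial>P) + (\<integral>\<^sup>+\<omega>. ?R \<omega> * ?h \<tau>' \<omega> * ?h \<tau> \<omega> \<partial>P)"
  proof (intro arg_cong2[where f="(+)"] nn_integral_alive_ordered)
    show "\<tau> \<notin> set (before \<omega> \<tau>')" if "?R \<omega> \<noteq> 0" for \<omega>
      using before_dichotomy[of \<tau> \<omega> \<tau>'] that by (auto split: split_indicator_asm)
  qed (use \<tau> Q in \<open>auto split: split_indicator_asm\<close>)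
  also have "\<dots> = (\<integral>\<^sup>+\<omega>. ?Q \<omega> * ?h \<tau> \<omega> * ?h \<tau>' \<omega> + ?R \<omega> * ?h \<tau>' \<omega> * ?h \<tau> \<omega> \<partial>P)"
    by (rule nn_integral_add[symmetric]) measurable
  also have "\<dots> = (\<integral>\<^sup>+\<omega>. ?h \<tau> \<omega> * ?h \<tau>' \<omega> \<partial>P)"
    by (intro nn_integral_cong) (simp add: ac_simps split: split_indicator)
  also have "\<dots> = (\<integral>\<^sup>+\<omega>. target_hit \<tau> \<omega> * (target_hit \<tau>' \<omega> *
       (presence t e (fst \<tau>) (arr \<omega> \<tau>) * presence t e (fst \<tau>') (arr \<omega> \<tau>'))) \<partial>P)"
    by (simp add: ac_simps)
  also have "\<dots> = ennreal (q (fst \<tau>)) * (\<integral>\<^sup>+\<omega>. target_hit \<tau>' \<omega> *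
       (presence t e (fst \<tau>) (arr \<omega> \<tau>) * presence t e (fst \<tau>') (arr \<omega> \<tau>')) \<partial>P)"
  proof (rule nn_integral_target_hit_mult[OF \<tau>(1)])
    let ?K = "insert (Target (fst \<tau>') (snd \<tau>')) interarrivals"
    have [measurable]: "target_hit \<tau>' \<in> borel_measurable (gen ?K)"
      by (rule measurable_gen_mono[OF measurable_target_hit_single[OF \<tau>(2)]]) auto
    have [measurable]: "(\<lambda>\<omega>. arr \<omega> \<tau>) \<in> borel_measurable (gen ?K)" "(\<lambda>\<omega>. arr \<omega> \<tau>') \<in> borel_measurable (gen ?K)"
      using \<tau> by (auto intro: measurable_gen_mono[OF measurable_arr_interarrivals])
    show "(\<lambda>\<omega>. target_hit \<tau>' \<omega> * (presence t e (fst \<tau>) (arr \<omega> \<tau>) * presence t e (fst \<tau>') (arr \<omega> \<tau>')))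
        \<in> borel_measurable (gen ?K)"
      by measurable
    show "?K \<subseteq> coords" using Target_in_coords[OF \<tau>(2)] interarrivals_subset by simp
    show "Target (fst \<tau>) (snd \<tau>) \<notin> ?K"
      using \<tau>(3) Target_notin_interarrivals by (simp add: prod_eq_iff)
  qed
  also have "(\<integral>\<^sup>+\<omega>. target_hit \<tau>' \<omega> * (presence t e (fst \<tau>) (arr \<omega> \<tau>) * presence t e (fst \<tau>') (arr \<omega> \<tau>')) \<partial>P) =
      ennreal (q (fst \<tau>')) * (\<integral>\<^sup>+\<omega>. presence t e (fst \<tau>) (arr \<omega> \<tau>) * presence t e (fst \<tau>') (arr \<omega> \<tau>') \<partial>P)"
  proof (rule nn_integral_target_hit_mult[OF \<tau>(2) _ interarrivals_subset Target_notin_interarrivals])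
    have [measurable]: "(\<lambda>\<omega>. arr \<omega> \<tau>) \<in> borel_measurable (gen interarrivals)"
      "(\<lambda>\<omega>. arr \<omega> \<tau>') \<in> borel_measurable (gen interarrivals)"
      using \<tau> by (auto intro: measurable_arr_interarrivals)
    show "(\<lambda>\<omega>. presence t e (fst \<tau>) (arr \<omega> \<tau>) * presence t e (fst \<tau>') (arr \<omega> \<tau>'))
        \<in> borel_measurable (gen interarrivals)"
      by measurable
  qed
  finally show ?thesis by (simp add: mult.assoc)
qed

end


section \<open>Second moment of the number of present tasks\<close>

lemma (in prob_space) chebyshev_ennreal:
  fixes Y :: "'a \<Rightarrow> ennreal"
  assumes [measurable]: "Y \<in> borel_measurable M"
    and Y1: "(\<integral>\<^sup>+\<omega>. Y \<omega> \<partial>M) = ennreal \<mu>" and Y2: "(\<integral>\<^sup>+\<omega>. Y \<omega> * Y \<omega> \<partial>M) = ennreal (\<mu>\<^sup>2 + \<mu>)"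
    and \<mu>: "0 \<le> \<mu>" "\<mu> < b"
  shows "prob {\<omega> \<in> space M. ennreal b \<le> Y \<omega>} \<le> \<mu> / (b - \<mu>)\<^sup>2"
proof -
  let ?A = "{\<omega> \<in> space M. ennreal b \<le> Y \<omega>}"
  have pointwise: "ennreal ((b - \<mu>)\<^sup>2) * indicator ?A \<omega> + ennreal (2 * \<mu>) * Y \<omega> \<le> Y \<omega> * Y \<omega> + ennreal (\<mu>\<^sup>2)"
    if "\<omega> \<in> space M" for \<omega>
  proof (cases "Y \<omega>")
    case (real y)
    have "(b - \<mu>)\<^sup>2 * indicator ?A \<omega> + 2 * \<mu> * y \<le> y * y + \<mu>\<^sup>2"
    proof (cases "b \<le> y")
      case True
      then have "(b - \<mu>)\<^sup>2 \<le> (y - \<mu>)\<^sup>2" using \<mu> by (intro power_mono) auto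
      then have "(b - \<mu>)\<^sup>2 + 2 * \<mu> * y \<le> y * y + \<mu>\<^sup>2" by (simp add: power2_eq_square algebra_simps)
      then show ?thesis using True real that by (simp add: ennreal_le_iff)
    next
      case False
      then have "\<omega> \<notin> ?A" using real \<mu> by (simp add: ennreal_le_iff)
      moreover have "0 \<le> (y - \<mu>)\<^sup>2" by simp
      ultimately show ?thesis by (simp add: power2_eq_square algebra_simps)
    qed
    then have "ennreal ((b - \<mu>)\<^sup>2 * indicator ?A \<omega> + 2 * \<mu> * y) \<le> ennreal (y * y + \<mu>\<^sup>2)"
      by (rule ennreal_leI)
    then show ?thesis using real \<mu>
      by (simp add: ennreal_plus ennreal_mult ennreal_indicator)
  qed (simp add: ennreal_top_mult)
  have "ennreal ((b - \<mu>)\<^sup>2) * emeasure M ?A + ennreal (2 * \<mu>) * ennreal \<mu> =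
      (\<integral>\<^sup>+\<omega>. ennreal ((b - \<mu>)\<^sup>2) * indicator ?A \<omega> + ennreal (2 * \<mu>) * Y \<omega> \<partial>M)"
    by (simp add: nn_integral_add nn_integral_cmult Y1)
  also have "\<dots> \<le> (\<integral>\<^sup>+\<omega>. Y \<omega> * Y \<omega> + ennreal (\<mu>\<^sup>2) \<partial>M)"
    by (rule nn_integral_mono) (rule pointwise)
  also have "\<dots> = ennreal (\<mu>\<^sup>2 + \<mu>) + ennreal (\<mu>\<^sup>2)"
    by (simp add: nn_integral_add Y2 emeasure_space_1)
  finally have "ennreal ((b - \<mu>)\<^sup>2 * prob ?A + 2 * \<mu> * \<mu>) \<le> ennreal (\<mu>\<^sup>2 + \<mu> + \<mu>\<^sup>2)"
    using \<mu> by (simp add: emeasure_eq_measure ennreal_mult[symmetric] ennreal_plus[symmetric] del: ennreal_plus)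
  then have "(b - \<mu>)\<^sup>2 * prob ?A + 2 * \<mu> * \<mu> \<le> \<mu>\<^sup>2 + \<mu> + \<mu>\<^sup>2"
    using \<mu> by (subst (asm) ennreal_le_iff) auto
  then have "(b - \<mu>)\<^sup>2 * prob ?A \<le> \<mu>" by (simp add: power2_eq_square)
  then show ?thesis using \<mu> by (simp add: pos_le_divide_eq mult.commute)
qed

lemma nn_integral_shifted_exponential:
  assumes "0 < l"
  shows "(\<integral>\<^sup>+x. ennreal (exponential_density l (t - x)) \<partial>lborel) = 1"
proof -
  have "(\<integral>\<^sup>+x. ennreal (exponential_density l x) \<partial>lborel) = 1"
    using prob_space.emeasure_space_1[OF prob_space_exponential_density[OF assms]]
    by (simp add: emeasure_density)
  then show ?thesis
    using nn_integral_real_affine[of "\<lambda>x. ennreal (exponential_density l x)" "-1" t] by simp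
qed

lemma (in prob_space) indep_vars_reindex:
  assumes "indep_vars (\<lambda>_. N) V (f ` I)" "inj_on f I"
  shows "indep_vars (\<lambda>_. N) (\<lambda>k. V (f k)) I"
  unfolding indep_vars_def2
proof (intro conjI ballI indep_setsI)
  let ?E = "\<lambda>c. {V c -` A \<inter> space M |A. A \<in> sets N}"
  show "random_variable N (V (f k))" "?E (f k) \<subseteq> events" if "k \<in> I" for k
    using assms(1) that unfolding indep_vars_def2 by (auto intro: measurable_sets)
  fix A J assume J: "J \<noteq> {}" "J \<subseteq> I" "finite J" and A: "\<forall>j\<in>J. A j \<in> ?E (f j)"
  have inj: "inj_on f J" using assms(2) J(2) by (rule inj_on_subset)
  have *: "the_inv_into J f (f j) = j" if "j \<in> J" for j
    using the_inv_into_f_f[OF inj that] .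
  have "prob (\<Inter>c\<in>f ` J. A (the_inv_into J f c)) = (\<Prod>c\<in>f ` J. prob (A (the_inv_into J f c)))"
    using assms(1) J A * unfolding indep_vars_def2 by (intro indep_setsD[of ?E "f ` I"]) auto
  then show "prob (\<Inter>j\<in>J. A j) = (\<Prod>j\<in>J. prob (A j))"
    using * by (simp add: prod.reindex[OF inj])
qed

lemma (in jiq_inputs) renewal:
  assumes "i \<in> dispatchers"
  shows "exponential_renewal P (X i) (lam i)"
proof
  have "indep_vars (\<lambda>_. borel) coord (range (Interarrival i))"
    using indep by (rule indep_vars_subset) (use assms in \<open>auto simp: coords_def\<close>)
  then have "indep_vars (\<lambda>_. borel) (\<lambda>k. coord (Interarrival i k)) UNIV"
    by (rule indep_vars_reindex) (simp add: inj_on_def)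
  then show "indep_vars (\<lambda>_. borel) (X i) UNIV" by (simp add: coord_def)
  show "distributed P lborel (X i k) (exponential_density (lam i))" for k
    using assms by (intro interarrival) auto
qed (use assms in auto)

context jiq_target
begin

definition load :: "real \<Rightarrow> real \<Rightarrow> nat \<Rightarrow> ennreal" where
  "load t e i = ennreal (q i) * (ennreal (lam i) * (\<integral>\<^sup>+x. presence t e i x * indicator {0..} x \<partial>lborel))"

lemma suminf_alive:
  assumes "i \<in> dispatchers"
  shows "(\<Sum>k. \<integral>\<^sup>+\<omega>. indicator (alive m t e (i, k)) \<omega> \<partial>P) = load t e i"
proof -
  interpret R: exponential_renewal P "X i" "lam i" by (rule renewal) fact
  have "(\<Sum>k. \<integral>\<^sup>+\<omega>. indicator (alive m t e (i, k)) \<omega> \<partial>P) =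
      (\<Sum>k. ennreal (q i) * (\<integral>\<^sup>+\<omega>. presence t e i (\<Sum>j\<le>k. X i j \<omega>) \<partial>P))"
    using assms by (intro suminf_cong, subst nn_integral_alive) (auto simp: valid_task_iff arrival_def)
  then show ?thesis
    by (simp add: R.campbell_first load_def)
qed

lemma suminf_alive_pair_same:
  assumes i: "i \<in> dispatchers"
  shows "(\<Sum>k. \<Sum>k'. \<integral>\<^sup>+\<omega>. indicator (alive m t e (i, k)) \<omega> * indicator (alive m t e (i, k')) \<omega> \<partial>P) =
    load t e i * load t e i + load t e i"
proof -
  interpret R: exponential_renewal P "X i" "lam i" by (rule renewal) fact
  let ?K = "\<lambda>k k'. \<integral>\<^sup>+\<omega>. presence t e i (\<Sum>j\<le>k. X i j \<omega>) * presence t e i (\<Sum>j\<le>k'. X i j \<omega>) \<partial>P"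
  let ?D = "\<lambda>k. \<integral>\<^sup>+\<omega>. indicator (alive m t e (i, k)) \<omega> \<partial>P"
  have "(\<integral>\<^sup>+\<omega>. indicator (alive m t e (i, k)) \<omega> * indicator (alive m t e (i, k')) \<omega> \<partial>P) =
     ennreal (q i) * ennreal (q i) * (if k \<noteq> k' then ?K k k' else 0) + (if k' = k then ?D k' else 0)" for k k'
  proof (cases "k = k'")
    case True
    then show ?thesis by (simp flip: indicator_inter_arith)
  next
    case False
    then show ?thesis
      using i by (subst nn_integral_alive_pair) (auto simp: valid_task_iff arrival_def)
  qed
  moreover have "(\<Sum>k'. if k' = k then ?D k' else 0) = ?D k" for k
    by (rule sums_unique[symmetric]) (rule sums_single)
  ultimately have "(\<Sum>k. \<Sum>k'. \<integral>\<^sup>+\<omega>. indicator (alive m t e (i, k)) \<omega> * indicator (alive m t e (i, k')) \<omega> \<partial>P) =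
     ennreal (q i) * ennreal (q i) * (\<Sum>k. \<Sum>k'. if k \<noteq> k' then ?K k k' else 0) + (\<Sum>k. ?D k)"
    by (simp add: suminf_add[symmetric] ennreal_suminf_cmult)
  then show ?thesis
    unfolding R.campbell_second[OF borel_measurable_presence] suminf_alive[OF i]
    by (simp add: load_def power2_eq_square ac_simps)
qed

lemma suminf_alive_pair_distinct:
  assumes i: "i \<in> dispatchers" "i' \<in> dispatchers" "i \<noteq> i'"
  shows "(\<Sum>k. \<Sum>k'. \<integral>\<^sup>+\<omega>. indicator (alive m t e (i, k)) \<omega> * indicator (alive m t e (i', k')) \<omega> \<partial>P) =
    load t e i * load t e i'"
proof -
  have meas: "(\<lambda>\<omega>. presence t e i (arr \<omega> (i, k))) \<in> borel_measurable (gen (range (Interarrival i)))" for i k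
  proof -
    have "coord (Interarrival i l) \<in> borel_measurable (gen (range (Interarrival i)))" for l
      by (rule measurable_gen_coord) simp
    then have "(\<lambda>\<omega>. arr \<omega> (i, k)) \<in> borel_measurable (gen (range (Interarrival i)))"
      by (auto simp: arrival_def coord_def intro!: borel_measurable_sum)
    then show ?thesis by measurable
  qed
  have "(\<integral>\<^sup>+\<omega>. indicator (alive m t e (i, k)) \<omega> * indicator (alive m t e (i', k')) \<omega> \<partial>P) =
    (\<integral>\<^sup>+\<omega>. indicator (alive m t e (i, k)) \<omega> \<partial>P) * (\<integral>\<^sup>+\<omega>. indicator (alive m t e (i', k')) \<omega> \<partial>P)" for k k'
  proof -
    have "(\<integral>\<^sup>+\<omega>. presence t e i (arr \<omega> (i, k)) * presence t e i' (arr \<omega> (i', k')) \<partial>P) =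
      (\<integral>\<^sup>+\<omega>. presence t e i (arr \<omega> (i, k)) \<partial>P) * (\<integral>\<^sup>+\<omega>. presence t e i' (arr \<omega> (i', k')) \<partial>P)"
      by (rule nn_integral_mult_indep[OF meas meas]) (use i in \<open>auto simp: coords_def\<close>)
    moreover have "(i, k) \<in> tasks" "(i', k') \<in> tasks" "(i, k) \<noteq> (i', k')"
      using i by (auto simp: valid_task_iff)
    ultimately show ?thesis
      by (simp add: nn_integral_alive nn_integral_alive_pair ac_simps)
  qed
  then show ?thesis
    by (simp add: suminf_alive[OF i(1)] suminf_alive[OF i(2)])
qed

lemma measurable_alive_sum:
  assumes "i \<in> dispatchers"
  shows "(\<lambda>\<omega>. \<Sum>k. indicator (alive m t e (i, k)) \<omega> :: ennreal) \<in> borel_measurable P"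
proof -
  have [measurable]: "alive m t e (i, k) \<in> sets P" for k
    using assms by (intro measurable_alive) (simp add: valid_task_iff)
  show ?thesis by measurable
qed

lemma measurable_alive_count [measurable]: "alive_count m t e \<in> borel_measurable P"
  unfolding alive_count_def[abs_def]
  by (intro borel_measurable_sum measurable_alive_sum)

lemma nn_integral_alive_count:
  "(\<integral>\<^sup>+\<omega>. alive_count m t e \<omega> \<partial>P) = (\<Sum>i\<in>dispatchers. load t e i)"
proof -
  have "(\<integral>\<^sup>+\<omega>. alive_count m t e \<omega> \<partial>P) = (\<Sum>i\<in>dispatchers. \<integral>\<^sup>+\<omega>. (\<Sum>k. indicator (alive m t e (i, k)) \<omega>) \<partial>P)"
    unfolding alive_count_def by (rule nn_integral_sum) (rule measurable_alive_sum)
  also have "\<dots> = (\<Sum>i\<in>dispatchers. load t e i)"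
  proof (rule sum.cong[OF refl])
    fix i assume i: "i \<in> dispatchers"
    have "alive m t e (i, k) \<in> sets P" for k
      using i by (intro measurable_alive) (simp add: valid_task_iff)
    then have "(\<integral>\<^sup>+\<omega>. (\<Sum>k. indicator (alive m t e (i, k)) \<omega>) \<partial>P) =
        (\<Sum>k. \<integral>\<^sup>+\<omega>. indicator (alive m t e (i, k)) \<omega> \<partial>P)"
      by (intro nn_integral_suminf) simp
    then show "(\<integral>\<^sup>+\<omega>. (\<Sum>k. indicator (alive m t e (i, k)) \<omega>) \<partial>P) = load t e i"
      by (simp only: suminf_alive[OF i])
  qed
  finally show ?thesis .
qed

lemma nn_integral_alive_count_squared:
  "(\<integral>\<^sup>+\<omega>. alive_count m t e \<omega> * alive_count m t e \<omega> \<partial>P) =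
    (\<Sum>i\<in>dispatchers. load t e i) * (\<Sum>i\<in>dispatchers. load t e i) + (\<Sum>i\<in>dispatchers. load t e i)"
proof -
  let ?Y = "\<lambda>i \<omega>. \<Sum>k. indicator (alive m t e (i, k)) \<omega> :: ennreal"
  have pair: "(\<integral>\<^sup>+\<omega>. ?Y i \<omega> * ?Y i' \<omega> \<partial>P) = load t e i * load t e i' + (if i = i' then load t e i else 0)"
    if i: "i \<in> dispatchers" "i' \<in> dispatchers" for i i'
  proof -
    have [measurable]: "alive m t e (i, k) \<in> sets P" "alive m t e (i', k) \<in> sets P" for k
      using i by (auto intro!: measurable_alive simp: valid_task_iff)
    have "(\<integral>\<^sup>+\<omega>. ?Y i \<omega> * ?Y i' \<omega> \<partial>P) =
      (\<integral>\<^sup>+\<omega>. (\<Sum>k. \<Sum>k'. indicator (alive m t e (i, k)) \<omega> * indicator (alive m t e (i', k')) \<omega>) \<partial>P)"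
      by (simp only: ennreal_suminf_cmult ennreal_suminf_multc)
    also have "\<dots> = (\<Sum>k. \<integral>\<^sup>+\<omega>. (\<Sum>k'. indicator (alive m t e (i, k)) \<omega> * indicator (alive m t e (i', k')) \<omega>) \<partial>P)"
      by (rule nn_integral_suminf) measurable
    also have "\<dots> = (\<Sum>k. \<Sum>k'. \<integral>\<^sup>+\<omega>. indicator (alive m t e (i, k)) \<omega> * indicator (alive m t e (i', k')) \<omega> \<partial>P)"
      by (intro suminf_cong nn_integral_suminf) measurable
    finally show ?thesis
      using suminf_alive_pair_same[OF i(1)] suminf_alive_pair_distinct[OF i] by (cases "i = i'") simp_all
  qed
  have "(\<integral>\<^sup>+\<omega>. alive_count m t e \<omega> * alive_count m t e \<omega> \<partial>P) =
      (\<integral>\<^sup>+\<omega>. (\<Sum>i\<in>dispatchers. \<Sum>i'\<in>dispatchers. ?Y i \<omega> * ?Y i' \<omega>) \<partial>P)"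
    unfolding alive_count_def sum_product ..
  also have "\<dots> = (\<Sum>i\<in>dispatchers. \<integral>\<^sup>+\<omega>. (\<Sum>i'\<in>dispatchers. ?Y i \<omega> * ?Y i' \<omega>) \<partial>P)"
    by (intro nn_integral_sum borel_measurable_sum borel_measurable_times_ennreal measurable_alive_sum)
  also have "\<dots> = (\<Sum>i\<in>dispatchers. \<Sum>i'\<in>dispatchers. \<integral>\<^sup>+\<omega>. ?Y i \<omega> * ?Y i' \<omega> \<partial>P)"
    by (intro sum.cong refl nn_integral_sum borel_measurable_times_ennreal measurable_alive_sum)
  also have "\<dots> = (\<Sum>i\<in>dispatchers. \<Sum>i'\<in>dispatchers. load t e i * load t e i' + (if i = i' then load t e i else 0))"
    by (intro sum.cong refl pair)
  also have "\<dots> = (\<Sum>i\<in>dispatchers. load t e i) * (\<Sum>i\<in>dispatchers. load t e i) + (\<Sum>i\<in>dispatchers. load t e i)"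
    by (simp add: sum.distrib sum_product)
  finally show ?thesis .
qed

lemma load_le:
  assumes "i \<in> dispatchers" "0 < q i \<Longrightarrow> 0 < \<rho> i" "t \<le> e"
  shows "load t e i \<le> ennreal (q i * lam i * (1 / \<rho> i + (e - t)))"
proof (cases "q i = 0")
  case False
  then have q: "0 < q i" and \<rho>: "0 < \<rho> i"
    using assms q_nonneg[of i] by auto
  have "presence t e i x * indicator {0..} x \<le>
      ennreal (1 / \<rho> i) * ennreal (exponential_density (\<rho> i) (t - x)) + indicator {t..e} x" for x
  proof (cases "x \<le> t")
    case True
    have "presence t e i x * indicator {0..} x \<le> survival i (t - x)"
      unfolding presence_def by (simp split: split_indicator)
    also have "\<dots> \<le> ennreal (exp (- \<rho> i * (t - x)))"
      unfolding survival_def by (intro ennreal_leI) simp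
    also have "exp (- \<rho> i * (t - x)) = 1 / \<rho> i * exponential_density (\<rho> i) (t - x)"
      using True \<rho> by (simp add: exponential_density_def algebra_simps)
    also have "ennreal \<dots> = ennreal (1 / \<rho> i) * ennreal (exponential_density (\<rho> i) (t - x))"
      using \<rho> by (intro ennreal_mult) (auto simp: exponential_density_nonneg)
    finally show ?thesis by (rule order_trans) simp
  next
    case False
    have "survival i (t - x) \<le> 1"
      unfolding survival_def by (simp flip: ennreal_1 add: ennreal_leI)
    then have "presence t e i x * indicator {0..} x \<le> indicator {t..e} x"
      using False by (simp add: presence_def split: split_indicator)
    then show ?thesis by (rule order_trans) simp
  qed
  then have "(\<integral>\<^sup>+x. presence t e i x * indicator {0..} x \<partial>lborel) \<le>
      (\<integral>\<^sup>+x. ennreal (1 / \<rho> i) * ennreal (exponential_density (\<rho> i) (t - x)) + indicator {t..e} x \<partial>lborel)"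
    by (intro nn_integral_mono) auto
  also have "\<dots> = ennreal (1 / \<rho> i) + ennreal (e - t)"
    using assms(3) by (simp add: nn_integral_add nn_integral_cmult nn_integral_shifted_exponential[OF \<rho>])
  finally have "load t e i \<le> ennreal (q i) * (ennreal (lam i) * (ennreal (1 / \<rho> i) + ennreal (e - t)))"
    unfolding load_def by (intro mult_left_mono) auto
  also have "\<dots> = ennreal (q i * lam i * (1 / \<rho> i + (e - t)))"
    using q \<rho> assms by (simp add: ennreal_mult ennreal_plus mult.assoc)
  finally show ?thesis .
qed (simp add: load_def)

lemma prob_alive_count_ge:
  assumes "\<And>i. i \<in> dispatchers \<Longrightarrow> 0 < q i \<Longrightarrow> 0 < \<rho> i" "t \<le> e"
    and B: "(\<Sum>i\<in>dispatchers. q i * lam i * (1 / \<rho> i + (e - t))) \<le> B" "B < b"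
  shows "\<P>(\<omega> in P. ennreal b \<le> alive_count m t e \<omega>) \<le> B / (b - B)\<^sup>2"
proof -
  have nonneg: "0 \<le> q i * lam i * (1 / \<rho> i + (e - t))" if "i \<in> dispatchers" for i
    using that q_nonneg[of i] \<rho>_nonneg[of i] assms(2) by auto
  have "(\<Sum>i\<in>dispatchers. load t e i) \<le> (\<Sum>i\<in>dispatchers. ennreal (q i * lam i * (1 / \<rho> i + (e - t))))"
    using assms(1,2) by (intro sum_mono load_le) auto
  also have "\<dots> = ennreal (\<Sum>i\<in>dispatchers. q i * lam i * (1 / \<rho> i + (e - t)))"
    by (rule sum_ennreal) (rule nonneg)
  also have "\<dots> \<le> ennreal B" by (rule ennreal_leI) (rule B)
  finally have le: "(\<Sum>i\<in>dispatchers. load t e i) \<le> ennreal B" .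
  have "0 \<le> (\<Sum>i\<in>dispatchers. q i * lam i * (1 / \<rho> i + (e - t)))"
    by (rule sum_nonneg) (rule nonneg)
  then have "0 \<le> B" using B(1) by linarith
  define \<mu> where "\<mu> = enn2real (\<Sum>i\<in>dispatchers. load t e i)"
  have \<mu>: "(\<Sum>i\<in>dispatchers. load t e i) = ennreal \<mu>" "0 \<le> \<mu>" "\<mu> \<le> B"
    unfolding \<mu>_def using le_less_trans[OF le ennreal_less_top] enn2real_mono[OF le ennreal_less_top] \<open>0 \<le> B\<close>
    by (simp_all only: ennreal_enn2real enn2real_nonneg enn2real_ennreal)
  have "\<P>(\<omega> in P. ennreal b \<le> alive_count m t e \<omega>) \<le> \<mu> / (b - \<mu>)\<^sup>2"
  proof (rule chebyshev_ennreal)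
    show "(\<integral>\<^sup>+\<omega>. alive_count m t e \<omega> \<partial>P) = ennreal \<mu>"
      by (simp only: nn_integral_alive_count \<mu>)
    show "(\<integral>\<^sup>+\<omega>. alive_count m t e \<omega> * alive_count m t e \<omega> \<partial>P) = ennreal (\<mu>\<^sup>2 + \<mu>)"
      using \<mu>(2) unfolding nn_integral_alive_count_squared \<mu>(1)
      by (simp add: power2_eq_square ennreal_mult ennreal_plus)
  qed (use \<mu> B in auto)
  also have "\<dots> \<le> B / (b - B)\<^sup>2"
    using \<mu> B(2) \<open>0 \<le> B\<close> by (intro frac_le power_mono) auto
  finally show ?thesis .
qed

end


section \<open>From present tasks to busy servers\<close>

lemma distinct_arriving_tasks: "distinct (arriving_tasks W lam x T)"
proof -
  have "distinct [(i, k). i \<leftarrow> is, 0 < lam i, k \<leftarrow> sorted_list_of_set {k. arrival x (i, k) \<le> T}]"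
    if "distinct is" for "is"
    using that by (induction "is") (auto simp: distinct_map inj_on_def)
  then show ?thesis
    unfolding arriving_tasks_def by (simp only: distinct_sort) (simp only: distinct_upt)
qed

lemma sorted_arriving_tasks: "sorted (map (arrival x) (arriving_tasks W lam x T))"
  unfolding arriving_tasks_def by (rule sorted_sort_key)

lemma arriving_tasks_le: "\<tau> \<in> set (arriving_tasks W lam x T) \<Longrightarrow> arrival x \<tau> \<le> T"
  unfolding arriving_tasks_def
  by (auto simp del: upt_Suc split: if_splits)
    (metis empty_iff finite.emptyI list.set(1) mem_Collect_eq set_sorted_list_of_set sorted_list_of_set.fold_insort_key.infinite)

lemma departure_idle: "\<not> busy hist t j \<Longrightarrow> departure hist t j s = ereal t + s"
  by (simp add: busy_def departure_def)

lemma assign_idle: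
  assumes "j = chosen_server policy a hist \<tau>" "\<not> busy hist (a \<tau>) j"
  shows "assign policy a s hist \<tau> = hist @ [(j, ereal (a \<tau>) + s \<tau> j)]"
  using assms by (simp add: assign_def Let_def departure_idle)

context jiq_pools
begin

lemma card_alive_le:
  assumes "finite A" "A \<subseteq> tasks" "\<And>\<tau>. \<tau> \<in> A \<Longrightarrow> \<omega> \<in> alive m t e \<tau>"
  shows "of_nat (card A) \<le> alive_count m t e \<omega>"
proof -
  define K where "K i = {k. (i, k) \<in> A}" for i
  have A: "A = (SIGMA i:dispatchers. K i)"
    using assms(2) by (auto simp: K_def valid_tasks_def)
  have fin: "finite (K i)" for i
    using finite_imageI[OF assms(1), of snd] by (rule finite_subset[rotated]) (force simp: K_def)
  have "of_nat (card A) = (\<Sum>i\<in>dispatchers. of_nat (card (K i)) :: ennreal)"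
    unfolding A by (subst card_SigmaI) (auto simp: fin)
  also have "\<dots> = (\<Sum>i\<in>dispatchers. \<Sum>k\<in>K i. indicator (alive m t e (i, k)) \<omega>)"
    using assms(3) by (intro sum.cong refl) (simp add: K_def)
  also have "\<dots> \<le> alive_count m t e \<omega>"
    unfolding alive_count_def by (intro sum_mono sum_le_suminf fin) auto
  finally show ?thesis .
qed

text \<open>
  As long as only idle servers are chosen, no task ever waits, so that every busy server of a pool
  accounts for one task that is present.\<close>

lemma not_assigned_to_busy:
  assumes \<omega>: "\<omega> \<in> space P"
    and U: "\<And>i k. (i, k) \<in> tasks \<Longrightarrow> U i k \<omega> \<in> {0..<1}"
    and Z: "\<And>i k. (i, k) \<in> tasks \<Longrightarrow> Z i k \<omega> \<in> types"
    and disjoint: "disjoint_family_on pool types"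
    and windows: "\<And>\<tau>. \<tau> \<in> tasks \<Longrightarrow> arr \<omega> \<tau> \<le> T \<Longrightarrow> \<exists>(t, e)\<in>windows. t \<le> arr \<omega> \<tau> \<and> arr \<omega> \<tau> \<le> e"
    and count: "\<And>m t e. m \<in> types \<Longrightarrow> (t, e) \<in> windows \<Longrightarrow> alive_count m t e \<omega> < of_nat (card (pool m))"
  shows "\<not> assigned_to_busy (policy \<omega>) (arr \<omega>) (srv \<omega>) [] (arriving T \<omega>)"
proof -
  let ?L = "arriving T \<omega>"
  let ?hist = "\<lambda>n. history_after (policy \<omega>) (arr \<omega>) (srv \<omega>) (take n ?L)"
  let ?entry = "\<lambda>\<tau>. (chosen \<omega> \<tau>, ereal (arr \<omega> \<tau>) + srv \<omega> \<tau> (chosen \<omega> \<tau>))"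
  have L: "set ?L \<subseteq> tasks" by (rule set_arriving_tasks)
  have pool_ne: "pool m \<noteq> {}" if "m \<in> types" "(t, e) \<in> windows" for m t e
    using count[OF that] by (auto simp: not_less)
  have nonempty: "pool (Z i k \<omega>) \<noteq> {}" if "(i, k) \<in> tasks" "arr \<omega> (i, k) \<le> T" for i k
    using windows[OF that] pool_ne[OF Z[OF that(1)]] by auto
  have chosen_in: "chosen \<omega> (i, k) \<in> pool (Z i k \<omega>)" if "(i, k) \<in> set ?L" for i k
    unfolding chosen_def using that L by (intro chosen_after_in_pool U nonempty arriving_tasks_le) auto
  have idle: "chosen \<omega> \<tau> = chosen_server (policy \<omega>) (arr \<omega>) (?hist n) \<tau> \<and>
      \<not> busy (?hist n) (arr \<omega> \<tau>) (chosen \<omega> \<tau>)"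
    if n: "n < length ?L" and \<tau>: "\<tau> = ?L ! n" and hist: "?hist n = map ?entry (take n ?L)" for n \<tau>
  proof -
    obtain i k where ik: "\<tau> = (i, k)" by (cases \<tau>)
    have \<tau>_in: "\<tau> \<in> set ?L" using n \<tau> by simp
    have before: "before \<omega> \<tau> = take n ?L"
    proof -
      have "takeWhile (\<lambda>\<tau>'. \<tau>' \<noteq> \<tau>) ?L = take n ?L"
      proof (rule takeWhile_eq_take_P_nth)
        show "?L ! j \<noteq> \<tau>" if "j < n" "j < length ?L" for j
          using that n \<tau> nth_eq_iff_index_eq[OF distinct_arriving_tasks] by auto
      qed (simp add: \<tau>)
      then show ?thesis by (simp add: before_def)
    qed
    then have chosen_eq: "chosen \<omega> \<tau> = chosen_server (policy \<omega>) (arr \<omega>) (?hist n) \<tau>"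
      by (simp add: chosen_def chosen_after_def)
    let ?m = "Z i k \<omega>" and ?B = "{j. busy (?hist n) (arr \<omega> \<tau>) j}"
    have "?m \<in> types" using Z \<tau>_in L ik by auto
    obtain t e where te: "(t, e) \<in> windows" "t \<le> arr \<omega> \<tau>" "arr \<omega> \<tau> \<le> e"
      using windows[of \<tau>] \<tau>_in L arriving_tasks_le[OF \<tau>_in] by auto
    let ?A = "{\<tau>' \<in> set ?L. \<omega> \<in> alive ?m t e \<tau>'}"
    have "pool ?m \<inter> ?B \<subseteq> chosen \<omega> ` ?A"
    proof safe
      fix j assume j: "j \<in> pool ?m" "busy (?hist n) (arr \<omega> \<tau>) j"
      then obtain \<tau>' where \<tau>': "\<tau>' \<in> set (take n ?L)" "j = chosen \<omega> \<tau>'"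
          "ereal (arr \<omega> \<tau>) < ereal (arr \<omega> \<tau>') + srv \<omega> \<tau>' j"
        unfolding hist by (auto simp: busy_def queue_def filter_empty_conv)
      obtain i' k' where ik': "\<tau>' = (i', k')" by (cases \<tau>')
      have \<tau>'_in: "\<tau>' \<in> set ?L" using \<tau>'(1) by (rule in_set_takeD)
      then have "j \<in> pool (Z i' k' \<omega>)" "Z i' k' \<omega> \<in> types"
        using chosen_in[of i' k'] Z[of i' k'] L \<tau>' ik' by auto
      then have Z_eq: "Z i' k' \<omega> = ?m"
        using disjoint \<open>?m \<in> types\<close> j(1) unfolding disjoint_family_on_def by blast
      have "arr \<omega> \<tau>' \<le> arr \<omega> \<tau>"
      proof -
        obtain l where "l < n" "\<tau>' = ?L ! l" using \<tau>'(1) by (auto simp: in_set_conv_nth)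
        then show ?thesis
          using sorted_nth_mono[OF sorted_arriving_tasks, of l n "\<lambda>i k. X i k \<omega>" W lam T] n \<tau> by simp
      qed
      moreover have "ereal (t - arr \<omega> \<tau>') < srv \<omega> \<tau>' j"
        using \<tau>'(3) te(2) by (cases "srv \<omega> \<tau>' j") auto
      ultimately have "\<omega> \<in> alive ?m t e \<tau>'"
        using \<omega> te Z_eq ik' \<tau>'(2) by (simp add: alive_def)
      then show "j \<in> chosen \<omega> ` ?A" using \<tau>'_in \<tau>'(2) by blast
    qed
    then have "card (pool ?m \<inter> ?B) \<le> card ?A"
      by (intro surj_card_le) auto
    moreover have "of_nat (card ?A) < (of_nat (card (pool ?m)) :: ennreal)"
    proof (rule le_less_trans)
      show "of_nat (card ?A) \<le> alive_count ?m t e \<omega>"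
        by (rule card_alive_le) (use L in auto)
    qed (rule count[OF \<open>?m \<in> types\<close> te(1)])
    ultimately have "card (pool ?m \<inter> ?B) < card (pool ?m)" by simp
    then have "\<not> pool ?m \<subseteq> ?B" by (auto simp: Int_absorb2)
    then have "policy \<omega> (i, k) ?B \<notin> ?B"
      using \<tau>_in L ik by (intro jiq_policy_in_pool finite_pool nonempty U arriving_tasks_le) auto
    then show ?thesis
      using chosen_eq by (simp add: chosen_server_def ik)
  qed
  have hist: "n \<le> length ?L \<Longrightarrow> ?hist n = map ?entry (take n ?L)" for n
  proof (induction n)
    case (Suc n)
    then have n: "n < length ?L" and IH: "?hist n = map ?entry (take n ?L)" by auto
    have "assign (policy \<omega>) (arr \<omega>) (srv \<omega>) (?hist n) (?L ! n) = ?hist n @ [?entry (?L ! n)]"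
      using idle[OF n refl IH] by (intro assign_idle) auto
    then show ?case
      using n IH by (simp add: take_Suc_conv_app_nth)
  qed simp
  show ?thesis
  proof
    assume "assigned_to_busy (policy \<omega>) (arr \<omega>) (srv \<omega>) [] ?L"
    then obtain n where n: "n < length ?L"
      and busy: "busy (?hist n) (arr \<omega> (?L ! n)) (chosen_server (policy \<omega>) (arr \<omega>) (?hist n) (?L ! n))"
      unfolding assigned_to_busy_iff Let_def by blast
    from idle[OF n refl hist[OF less_imp_le[OF n]]] busy show False by metis
  qed
qed

lemma AE_X_pos:
  assumes "i \<in> dispatchers"
  shows "AE \<omega> in P. 0 < X i k \<omega>"
proof -
  have D: "distributed P lborel (X i k) (exponential_density (lam i))"
    using assms by (intro interarrival) auto
  have "\<P>(\<omega> in P. 0 < X i k \<omega>) = 1"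
    using exponential_distributedD_gt[OF D, of 0] assms by simp
  moreover have "{\<omega> \<in> space P. 0 < X i k \<omega>} \<in> events"
    using distributed_measurable[OF D] by measurable
  ultimately show ?thesis by (simp add: prob_Collect_eq_1)
qed

lemma AE_Z:
  assumes "i \<in> dispatchers" "h \<in> {1..H}" "i \<in> cls h" "(\<Sum>m=1..M. p h m) = 1"
  shows "AE \<omega> in P. Z i k \<omega> \<in> {1..M}"
proof -
  have [measurable]: "Z i k \<in> measurable P (count_space UNIV)"
    using assms(1) by (intro measurable_gen_imp[OF measurable_Z_all_but_service all_but_service_subset[of "{}"]]) (simp add: valid_task_iff)
  have eq: "{\<omega> \<in> space P. Z i k \<omega> \<in> {1..M}} = (\<Union>m\<in>{1..M}. {\<omega> \<in> space P. Z i k \<omega> = m})" by auto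
  then have "\<P>(\<omega> in P. Z i k \<omega> \<in> {1..M}) = (\<Sum>m=1..M. \<P>(\<omega> in P. Z i k \<omega> = m))"
    by (simp only:) (rule finite_measure_finite_Union; auto simp: disjoint_family_on_def)
  also have "\<dots> = 1"
    using assms by (subst assms(4)[symmetric], intro sum.cong refl target) auto
  finally have "\<P>(\<omega> in P. Z i k \<omega> \<in> {1..M}) = 1" .
  moreover have "{\<omega> \<in> space P. Z i k \<omega> \<in> {1..M}} \<in> events" unfolding eq by measurable
  ultimately show ?thesis by (rule prob_Collect_eq_1[THEN iffD1, rotated])
qed

lemma prob_busy_le:
  assumes Z: "\<And>i k. (i, k) \<in> tasks \<Longrightarrow> AE \<omega> in P. Z i k \<omega> \<in> types"
    and disjoint: "disjoint_family_on pool types"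
    and finite: "finite types" "finite windows"
    and windows: "\<And>x. 0 \<le> x \<Longrightarrow> x \<le> T \<Longrightarrow> \<exists>(t, e)\<in>windows. t \<le> x \<and> x \<le> e"
    and meas: "\<And>m t e. m \<in> types \<Longrightarrow> alive_count m t e \<in> borel_measurable P"
  shows "prob (jiq_busy_event P N W pool lam rate X Z U S T) \<le>
    (\<Sum>m\<in>types. \<Sum>(t, e)\<in>windows. \<P>(\<omega> in P. ennreal (card (pool m)) \<le> alive_count m t e \<omega>))"
proof -
  let ?E = "jiq_busy_event P N W pool lam rate X Z U S T"
  let ?A = "\<lambda>(m, t, e). {\<omega> \<in> space P. ennreal (card (pool m)) \<le> alive_count m t e \<omega>}"
  have A: "?A c \<in> events" if "c \<in> types \<times> windows" for c
    using that meas by (cases c) auto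
  have tasks: "countable tasks" by simp
  have "AE \<omega> in P. \<forall>\<tau>\<in>tasks. U (fst \<tau>) (snd \<tau>) \<omega> \<in> {0..<1} \<and> Z (fst \<tau>) (snd \<tau>) \<omega> \<in> types \<and>
      0 < X (fst \<tau>) (snd \<tau>) \<omega>"
    by (subst AE_ball_countable[OF tasks])
      (auto intro!: AE_conjI AE_U Z AE_X_pos simp: valid_task_iff simp del: atLeastLessThan_iff)
  then have "AE \<omega> in P. \<omega> \<in> ?E \<longrightarrow> \<omega> \<in> (\<Union>c\<in>types \<times> windows. ?A c)"
    using AE_space
  proof eventually_elim
    case (elim \<omega>)
    have arr_nonneg: "0 \<le> arr \<omega> \<tau>" if "\<tau> \<in> tasks" for \<tau>
    proof (cases \<tau>)
      case (Pair i k)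
      have "0 \<le> X i l \<omega>" for l
        using elim(1)[rule_format, of "(i, l)"] that by (simp add: Pair valid_task_iff)
      then show ?thesis by (simp add: Pair arrival_def sum_nonneg)
    qed
    show ?case
    proof (rule impI, rule ccontr)
      assume E: "\<omega> \<in> ?E" and "\<omega> \<notin> (\<Union>c\<in>types \<times> windows. ?A c)"
      then have count: "alive_count m t e \<omega> < of_nat (card (pool m))" if "m \<in> types" "(t, e) \<in> windows" for m t e
        using that elim(2) by (fastforce simp: not_le ennreal_of_nat_eq_real_of_nat)
      have "\<not> assigned_to_busy (policy \<omega>) (arr \<omega>) (srv \<omega>) [] (arriving T \<omega>)"
      proof (rule not_assigned_to_busy[OF elim(2) _ _ disjoint])
        show "\<exists>(t, e)\<in>windows. t \<le> arr \<omega> \<tau> \<and> arr \<omega> \<tau> \<le> e" if "\<tau> \<in> tasks" "arr \<omega> \<tau> \<le> T" for \<tau>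
          using that by (intro windows arr_nonneg)
        show "U i k \<omega> \<in> {0..<1}" "Z i k \<omega> \<in> types" if "(i, k) \<in> tasks" for i k
          using elim(1)[rule_format, OF that] by auto
      qed (rule count)
      then show False using E by (simp add: jiq_busy_event_def Let_def)
    qed
  qed
  then have "prob ?E \<le> prob (\<Union>c\<in>types \<times> windows. ?A c)"
    using finite A by (intro finite_measure_mono_AE) auto
  also have "\<dots> \<le> (\<Sum>c\<in>types \<times> windows. prob (?A c))"
    using finite A by (intro finite_measure_subadditive_finite) auto
  also have "\<dots> = (\<Sum>m\<in>types. \<Sum>(t, e)\<in>windows. prob (?A (m, t, e)))"
    by (simp add: sum.cartesian_product case_prod_beta)
  finally show ?thesis by simp
qed

end


section \<open>The limit\<close>

lemma unit_partition_cellE: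
  assumes "unit_partition n w" "x \<in> {0..<1}"
  obtains h where "h \<in> {1..n}" "x \<in> cell w h"
proof -
  define h where "h = (LEAST h. x < w h)"
  have n: "x < w n" using assms by (simp add: unit_partition_def)
  then have "x < w h" unfolding h_def by (rule LeastI)
  moreover have "h \<le> n" unfolding h_def using n by (rule Least_le)
  moreover have "h \<noteq> 0" using \<open>x < w h\<close> assms by (auto simp: unit_partition_def intro: ccontr)
  moreover from this have "w (h - 1) \<le> x"
    using not_less_Least[of "h - 1" "\<lambda>h. x < w h"] by (simp add: h_def)
  ultimately show ?thesis by (intro that[of h]) (auto simp: cell_def)
qed

lemma disjoint_cells:
  assumes "unit_partition n w"
  shows "disjoint_family_on (cell w) {1..n}"
proof -
  have "cell w h \<inter> cell w h' = {}" if "h \<in> {1..n}" "h' \<in> {1..n}" "h < h'" for h h'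
  proof -
    have "w h \<le> w (h' - 1)"
      using assms that unfolding unit_partition_def
      by (intro strict_mono_on_leD[of "{0..n}" w]) auto
    then show ?thesis by (auto simp: cell_def)
  qed
  then show ?thesis
    unfolding disjoint_family_on_def by (metis Int_commute linorder_less_linear)
qed

lemma unit_partition_pos:
  assumes "unit_partition n w" "h \<in> {1..n}"
  shows "w (h - 1) < w h"
  using assms unfolding unit_partition_def by (intro strict_mono_onD[of "{0..n}" w]) auto

lemma subcritical_load:
  assumes "stepwise H M w v r f" "subcritical H M w v r \<phi>\<^sub>1 \<phi>\<^sub>2 W lam \<Lambda> p" and m: "m \<in> {1..M}"
  shows "\<And>h. h \<in> {1..H} \<Longrightarrow> 0 < p h m \<Longrightarrow> 0 < r h m"
    and "(\<Sum>h=1..H. \<Lambda> h * p h m * (1 / r h m)) < v m - v (m - 1)"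
proof -
  let ?c = "v m - v (m - 1)"
  let ?t = "\<lambda>h. ereal (\<Lambda> h * p h m) / ereal (r h m * ?c)"
  have c: "0 < ?c"
    using assms(1) m unit_partition_pos[of M v m] by (auto simp: stepwise_def)
  have r: "0 \<le> r h m" if "h \<in> {1..H}" for h
    using assms(1) m that by (auto simp: stepwise_def)
  have p: "0 \<le> p h m" "0 < \<Lambda> h" if "h \<in> {1..H}" for h
    using assms(2) m that by (auto simp: subcritical_def)
  have sum: "(\<Sum>h=1..H. ?t h) < 1"
    using assms(2) m by (auto simp: subcritical_def)
  have t_nonneg: "0 \<le> ?t h" if "h \<in> {1..H}" for h
    using p[OF that] r[OF that] c by (intro zero_le_divide_ereal) auto
  show r_pos: "0 < r h m" if h: "h \<in> {1..H}" "0 < p h m" for h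
  proof (rule ccontr)
    assume "\<not> 0 < r h m"
    then have "?t h = \<infinity>" using r[OF h(1)] p[OF h(1)] h(2) by simp
    moreover have "?t h \<le> (\<Sum>h=1..H. ?t h)"
      using sum_mono2[of "{1..H}" "{h}" ?t] h(1) t_nonneg by simp
    ultimately show False using sum by simp
  qed
  have "?t h = ereal (\<Lambda> h * p h m * (1 / r h m) / ?c)" if "h \<in> {1..H}" for h
  proof (cases "p h m = 0")
    case False
    then have "0 < r h m" using r_pos[OF that] p[OF that] by simp
    then show ?thesis using c by simp
  qed simp
  then have "(\<Sum>h=1..H. ?t h) = (\<Sum>h=1..H. ereal (\<Lambda> h * p h m * (1 / r h m) / ?c))"
    by (rule sum.cong[OF refl])
  then have "ereal (\<Sum>h=1..H. \<Lambda> h * p h m * (1 / r h m) / ?c) < 1"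
    using sum by (simp only: sum_ereal)
  then show "(\<Sum>h=1..H. \<Lambda> h * p h m * (1 / r h m)) < ?c"
    using c unfolding sum_divide_distrib[symmetric] one_ereal_def ereal_less_eq less_ereal.simps(1)
    by (subst (asm) divide_less_eq_1_pos) auto
qed

lemma tendsto_ratio_bound:
  fixes B b :: "nat \<Rightarrow> real"
  assumes B: "(\<lambda>N. B N / real N) \<longlonglongrightarrow> \<beta>" and b: "(\<lambda>N. b N / real N) \<longlonglongrightarrow> c" and "\<beta> < c"
  shows "(\<lambda>N. B N / (b N - B N)\<^sup>2) \<longlonglongrightarrow> 0" and "\<forall>\<^sub>F N in sequentially. B N < b N"
proof -
  have diff: "(\<lambda>N. b N / real N - B N / real N) \<longlonglongrightarrow> c - \<beta>"
    by (intro tendsto_diff B b)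
  have "(\<lambda>N. B N / real N / (b N / real N - B N / real N)\<^sup>2 * (1 / real N)) \<longlonglongrightarrow> \<beta> / (c - \<beta>)\<^sup>2 * 0"
    using assms(3) by (intro tendsto_intros B diff lim_1_over_n) auto
  moreover have "\<forall>\<^sub>F N in sequentially. B N / real N / (b N / real N - B N / real N)\<^sup>2 * (1 / real N) =
      B N / (b N - B N)\<^sup>2"
    using eventually_gt_at_top[of 0]
    by eventually_elim (simp add: diff_divide_distrib[symmetric] power2_eq_square)
  ultimately show "(\<lambda>N. B N / (b N - B N)\<^sup>2) \<longlonglongrightarrow> 0"
    by (simp only: tendsto_cong mult_zero_right)
  have "\<forall>\<^sub>F N in sequentially. 0 < b N / real N - B N / real N"
    using diff assms(3) by (intro order_tendstoD) auto
  then show "\<forall>\<^sub>F N in sequentially. B N < b N"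
    using eventually_gt_at_top[of 0]
    by eventually_elim (simp add: diff_divide_distrib[symmetric] zero_less_divide_iff)
qed

theorem corollary3p8:
  fixes f :: "real \<Rightarrow> real \<Rightarrow> real"
    and \<phi>\<^sub>1 \<phi>\<^sub>2 w v \<Lambda> :: "nat \<Rightarrow> real"
    and H M :: nat
    and r p :: "nat \<Rightarrow> nat \<Rightarrow> real"
    and W :: "nat \<Rightarrow> nat"
    and lam :: "nat \<Rightarrow> nat \<Rightarrow> real"
    and \<mu> :: "nat \<Rightarrow> nat \<Rightarrow> nat \<Rightarrow> real"
    and P :: "nat \<Rightarrow> 'a measure"
    and X U :: "nat \<Rightarrow> nat \<Rightarrow> nat \<Rightarrow> 'a \<Rightarrow> real"
    and Z :: "nat \<Rightarrow> nat \<Rightarrow> nat \<Rightarrow> 'a \<Rightarrow> nat"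
    and S :: "nat \<Rightarrow> nat \<Rightarrow> nat \<Rightarrow> nat \<Rightarrow> 'a \<Rightarrow> real"
    and T :: real
  assumes "f_sequence f \<phi>\<^sub>1 \<phi>\<^sub>2 W \<mu>"
    and "stepwise H M w v r f"
    and "subcritical H M w v r \<phi>\<^sub>1 \<phi>\<^sub>2 W lam \<Lambda> p"
    and "\<And>N. N \<ge> 1 \<Longrightarrow>
           jiq_inputs (P N) N (W N) H M (of_type \<phi>\<^sub>1 w (W N)) p (lam N) (\<mu> N) (X N) (Z N) (U N) (S N)"
    and "T > 0"
  defines "E \<equiv> \<lambda>N. jiq_busy_event (P N) N (W N) (of_type \<phi>\<^sub>2 v N) (lam N) (\<mu> N)
                     (X N) (Z N) (U N) (S N) T"
  shows "(\<forall>N\<ge>1. E N \<in> sets (P N)) \<and> (\<lambda>N. measure (P N) (E N)) \<longlonglongrightarrow> 0"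
proof
  have pools: "jiq_pools (P N) N (W N) H M (of_type \<phi>\<^sub>1 w (W N)) p (lam N) (\<mu> N) (X N) (Z N) (U N) (S N)
      (of_type \<phi>\<^sub>2 v N)" if "N \<ge> 1" for N
    using assms(4)[OF that] by (auto simp: jiq_pools_def jiq_pools_axioms_def of_type_def)
  show "\<forall>N\<ge>1. E N \<in> sets (P N)"
    unfolding E_def using jiq_pools.sets_jiq_busy_event[OF pools] by blast

  have partitions: "unit_partition H w" "unit_partition M v"
    using assms(2) by (auto simp: stepwise_def)
  have p_nonneg: "0 \<le> p h m" if "h \<in> {1..H}" "m \<in> {1..M}" for h m
    using assms(3) that by (auto simp: subcritical_def)
  define c where "c m = v m - v (m - 1)" for m
  define \<sigma> where "\<sigma> m = (\<Sum>h=1..H. \<Lambda> h * p h m * (1 / r h m))" for m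
  define \<beta> where "\<beta> d m = (\<Sum>h=1..H. \<Lambda> h * p h m * (1 / r h m + d))" for d m
  have "\<forall>\<^sub>F K in sequentially. \<beta> (T / real K) m < c m" if "m \<in> {1..M}" for m
  proof (rule order_tendstoD)
    have "(\<lambda>K. \<beta> (T / real K) m) \<longlonglongrightarrow> (\<Sum>h=1..H. \<Lambda> h * p h m * (1 / r h m + 0))"
      unfolding \<beta>_def by (intro tendsto_intros lim_const_over_n)
    then show "(\<lambda>K. \<beta> (T / real K) m) \<longlonglongrightarrow> \<sigma> m" by (simp add: \<sigma>_def)
    show "\<sigma> m < c m" unfolding \<sigma>_def c_def by (rule subcritical_load(2)[OF assms(2,3) that])
  qed
  then have "\<forall>\<^sub>F K in sequentially. (\<forall>m\<in>{1..M}. \<beta> (T / real K) m < c m) \<and> 0 < K"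
    by (intro eventually_conj eventually_ball_finite eventually_gt_at_top) auto
  then obtain K where K: "\<And>m. m \<in> {1..M} \<Longrightarrow> \<beta> (T / real K) m < c m" "0 < K"
    using eventually_happens'[OF sequentially_bot] by blast
  define d where "d = T / real K"
  have d: "0 < d" using assms(5) K(2) by (simp add: d_def)
  define windows where "windows = (\<lambda>k. (real k * d, real k * d + d)) ` {..K}"
  have windows: "\<exists>(t, e)\<in>windows. t \<le> x \<and> x \<le> e" if "0 \<le> x" "x \<le> T" for x
  proof -
    let ?k = "nat \<lfloor>x / d\<rfloor>"
    have "x / d \<le> real K" using that K(2) assms(5) by (simp add: d_def field_simps)
    then have "?k \<le> K" by linarith
    moreover have "real ?k \<le> x / d" "x / d \<le> real ?k + 1"
      using that d by (simp_all add: of_nat_nat)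
    then have "real ?k * d \<le> x" "x \<le> real ?k * d + d"
      using d by (simp_all add: field_simps)
    ultimately show ?thesis unfolding windows_def by blast
  qed

  define B where "B m N = (\<Sum>h=1..H. p h m * (1 / r h m + d) * (\<Sum>i\<in>of_type \<phi>\<^sub>1 w (W N) h. lam N i))" for m N
  define b where "b m N = real (card (of_type \<phi>\<^sub>2 v N m))" for m N
  have b_lim: "(\<lambda>N. b m N / real N) \<longlonglongrightarrow> c m" if "m \<in> {1..M}" for m
    using assms(3) that by (auto simp: subcritical_def b_def c_def)
  have B_lim: "(\<lambda>N. B m N / real N) \<longlonglongrightarrow> \<beta> d m" if "m \<in> {1..M}" for m
  proof -
    have "(\<lambda>N. \<Sum>h=1..H. p h m * (1 / r h m + d) * ((\<Sum>i\<in>of_type \<phi>\<^sub>1 w (W N) h. lam N i) / real N))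
        \<longlonglongrightarrow> (\<Sum>h=1..H. p h m * (1 / r h m + d) * \<Lambda> h)"
      using assms(3) by (intro tendsto_sum tendsto_mult_left) (auto simp: subcritical_def)
    moreover have "(\<Sum>h=1..H. p h m * (1 / r h m + d) * ((\<Sum>i\<in>of_type \<phi>\<^sub>1 w (W N) h. lam N i) / real N)) =
        B m N / real N" for N
      unfolding B_def sum_divide_distrib[of _ "{1..H}"] by (intro sum.cong refl) simp
    moreover have "(\<Sum>h=1..H. p h m * (1 / r h m + d) * \<Lambda> h) = \<beta> d m"
      unfolding \<beta>_def by (intro sum.cong refl) simp
    ultimately show ?thesis by (simp only:)
  qed
  have lt: "\<beta> d m < c m" if "m \<in> {1..M}" for m
    using K(1)[OF that] by (simp add: d_def)
  note ratio = tendsto_ratio_bound[OF B_lim b_lim lt]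

  have bound: "measure (P N) (E N) \<le> (\<Sum>m=1..M. \<Sum>_\<in>windows. B m N / (b m N - B m N)\<^sup>2)"
    if N: "1 \<le> N" and Bb: "\<forall>m\<in>{1..M}. B m N < b m N" for N
  proof -
    define ty where "ty i = (SOME h. h \<in> {1..H} \<and> \<phi>\<^sub>1 i \<in> cell w h)" for i
    have ty: "ty i \<in> {1..H}" "\<phi>\<^sub>1 i \<in> cell w (ty i)" if "i \<ge> 1" for i
    proof -
      have "\<phi>\<^sub>1 i \<in> {0..<1}" using assms(1) that by (simp add: f_sequence_def)
      then have "\<exists>h. h \<in> {1..H} \<and> \<phi>\<^sub>1 i \<in> cell w h"
        using unit_partition_cellE[OF partitions(1)] by metis
      from someI_ex[OF this] show "ty i \<in> {1..H}" "\<phi>\<^sub>1 i \<in> cell w (ty i)"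
        by (auto simp: ty_def)
    qed
    interpret J: jiq_pools "P N" N "W N" H M "of_type \<phi>\<^sub>1 w (W N)" p "lam N" "\<mu> N" "X N" "Z N" "U N" "S N"
      "of_type \<phi>\<^sub>2 v N" T
      by (rule pools) fact
    have B_ge: "(\<Sum>i\<in>J.dispatchers. p (ty i) m * lam N i * (1 / r (ty i) m + d)) \<le> B m N"
      if m: "m \<in> {1..M}" for m
    proof -
      have "(\<Sum>i\<in>J.dispatchers. p (ty i) m * lam N i * (1 / r (ty i) m + d)) =
        (\<Sum>h=1..H. \<Sum>i | i \<in> J.dispatchers \<and> ty i = h. p (ty i) m * lam N i * (1 / r (ty i) m + d))"
        by (rule sum.group[symmetric]) (use ty in auto)
      also have "\<dots> = (\<Sum>h=1..H. p h m * (1 / r h m + d) * (\<Sum>i | i \<in> J.dispatchers \<and> ty i = h. lam N i))"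
        unfolding sum_distrib_left by (intro sum.cong refl) auto
      also have "\<dots> \<le> B m N"
        unfolding B_def
      proof (intro sum_mono mult_left_mono sum_mono2)
        fix h assume h: "h \<in> {1..H}"
        show "0 \<le> p h m * (1 / r h m + d)"
          using p_nonneg[OF h m] d assms(2) h m by (auto simp: stepwise_def)
        show "{i \<in> J.dispatchers. ty i = h} \<subseteq> of_type \<phi>\<^sub>1 w (W N) h"
          using ty by (auto simp: of_type_def)
      qed (auto simp: of_type_def intro: J.lam_nonneg)
      finally show ?thesis .
    qed
    have target: "jiq_target (P N) N (W N) H M (of_type \<phi>\<^sub>1 w (W N)) p (lam N) (\<mu> N) (X N) (Z N) (U N) (S N)
      (of_type \<phi>\<^sub>2 v N) m (\<lambda>i. r (ty i) m) (\<lambda>i. p (ty i) m)" if m: "m \<in> {1..M}" for m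
    proof
      have "0 \<le> B m N"
        using p_nonneg m ty d assms(2)
        by (intro order_trans[OF sum_nonneg B_ge[OF m]]) (auto simp: stepwise_def)
      then show "of_type \<phi>\<^sub>2 v N m \<noteq> {}"
        using bspec[OF Bb m] by (auto simp: b_def)
    next
      fix i j assume i: "i \<in> {1..W N}" and j: "j \<in> of_type \<phi>\<^sub>2 v N m"
      then have "\<mu> N i j = f (\<phi>\<^sub>1 i) (\<phi>\<^sub>2 j)"
        using assms(1) N by (auto simp: f_sequence_def of_type_def)
      also have "\<dots> = r (ty i) m"
        using assms(2) m ty[of i] i j by (auto simp: stepwise_def of_type_def)
      finally show "\<mu> N i j = r (ty i) m" .
    next
      fix i k assume i: "i \<in> {1..W N}" "0 < lam N i"
      show "0 \<le> r (ty i) m" "0 \<le> p (ty i) m"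
        using i m ty[of i] p_nonneg assms(2) by (auto simp: stepwise_def)
      show "\<P>(\<omega> in P N. Z N i k \<omega> = m) = p (ty i) m"
        using i m ty[of i] by (intro J.target) (auto simp: of_type_def)
    qed
    have "measure (P N) (E N) \<le> (\<Sum>m=1..M. \<Sum>(t, e)\<in>windows.
        \<P>(\<omega> in P N. ennreal (card (of_type \<phi>\<^sub>2 v N m)) \<le> J.alive_count m t e \<omega>))"
      unfolding E_def
    proof (rule J.prob_busy_le)
      fix i k assume "(i, k) \<in> J.tasks"
      then have i: "i \<in> J.dispatchers" by (simp add: J.valid_task_iff)
      then show "AE \<omega> in P N. Z N i k \<omega> \<in> {1..M}"
        using ty[of i] assms(3) by (intro J.AE_Z[of i "ty i"]) (auto simp: of_type_def subcritical_def)
    next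
      show "disjoint_family_on (of_type \<phi>\<^sub>2 v N) {1..M}"
        using disjoint_cells[OF partitions(2)] unfolding disjoint_family_on_def of_type_def by blast
      show "J.alive_count m t e \<in> borel_measurable (P N)" if "m \<in> {1..M}" for m t e
        using jiq_target.measurable_alive_count[OF target[OF that]] .
    qed (use windows in \<open>auto simp: windows_def\<close>)
    also have "\<dots> \<le> (\<Sum>m=1..M. \<Sum>_\<in>windows. B m N / (b m N - B m N)\<^sup>2)"
    proof (intro sum_mono, clarify)
      fix m t e assume m: "m \<in> {1..M}" and "(t, e) \<in> windows"
      then have e: "e - t = d" "t \<le> e" using d by (auto simp: windows_def)
      show "\<P>(\<omega> in P N. ennreal (card (of_type \<phi>\<^sub>2 v N m)) \<le> J.alive_count m t e \<omega>) \<le> B m N / (b m N - B m N)\<^sup>2"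
        unfolding b_def
      proof (rule jiq_target.prob_alive_count_ge[OF target[OF m] _ e(2)])
        show "0 < r (ty i) m" if "i \<in> J.dispatchers" "0 < p (ty i) m" for i
          using subcritical_load(1)[OF assms(2,3) m ty(1)] that by auto
        show "(\<Sum>i\<in>J.dispatchers. p (ty i) m * lam N i * (1 / r (ty i) m + (e - t))) \<le> B m N"
          unfolding e(1) by (rule B_ge[OF m])
        show "B m N < real (card (of_type \<phi>\<^sub>2 v N m))" using Bb m by (simp add: b_def)
      qed
    qed
    finally show ?thesis .
  qed
  show "(\<lambda>N. measure (P N) (E N)) \<longlonglongrightarrow> 0"
  proof (rule tendsto_sandwich[where f="\<lambda>_. 0"])
    have "\<forall>\<^sub>F N in sequentially. \<forall>m\<in>{1..M}. B m N < b m N"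
      using ratio(2) by (intro eventually_ball_finite) auto
    then show "\<forall>\<^sub>F N in sequentially. measure (P N) (E N) \<le> (\<Sum>m=1..M. \<Sum>_\<in>windows. B m N / (b m N - B m N)\<^sup>2)"
      using eventually_ge_at_top[of 1] by eventually_elim (rule bound)
    have "(\<lambda>N. \<Sum>m=1..M. \<Sum>_\<in>windows. B m N / (b m N - B m N)\<^sup>2) \<longlonglongrightarrow> (\<Sum>m=1..M. \<Sum>_\<in>windows. 0)"
      by (intro tendsto_sum ratio(1)) auto
    then show "(\<lambda>N. \<Sum>m=1..M. \<Sum>_\<in>windows. B m N / (b m N - B m N)\<^sup>2) \<longlonglongrightarrow> 0" by simp
  qed auto
qed

end
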